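(* Let $k$ be a field, $n\ge2$, and let $\mathcal A$ and $\mathcal U$ be the complexes described in the context: $\mathcal A$ is the Hilbert-Burch dg algebra resolving $R=Q/I_n$ over $Q$, and $\mathcal U$ is the minimal graded $Q$-free resolution of $\operatorname{coker}J^T_R$. Then $\mathcal U$ admits the structure of a dg module over the dg algebra $\mathcal A$. Such a structure is given by $$e_i\cdot a_j=\begin{cases}(-1)^j\displaystyle\sum_{k=1}^nx_{k,j}b_{k,i},& i\ne j,\\[2mm](-1)^{i+1}\Big(\displaystyle\sum_{k\ne i}x_{1,k}b_{1,k}-\sum_{\ell\ne1}x_{\ell,i}b_{\ell,i}\Big),& i=j,\end{cases}$$ $$e_i\cdot b_{j,k}=(-1)^{i+1}\sum_{\ell=1}^n\frac{\partial F_i}{\partial x_{\ell,k}}c_{\ell,j},\qquad e_i\cdot c_{j,k}=0,$$ $$T_i\cdot a_j=(-1)^j\sum_{k=1}^nx_{k,j}c_{i,k},\qquad T_i\cdot b_{j,k}=0,\qquad T_i\cdot c_{j,k}=0,$$ for all basis elements of $\mathcal A$ and $\mathcal U$ (in $e_i\cdot a_i$ the first sum is over $k\in\{1,\dots,n+1\}\setminus\{i\}$ and the second over $\ell\in\{2,\dots,n\}$).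
   Context: $Q=k[x_{i,j}\mid 1\le i\le n,\ 1\le j\le n+1]$, $X=(x_{i,j})$ is the generic $n\times(n+1)$ matrix, $X_\alpha^\beta$ is $X$ with the columns in $\alpha$ and rows in $\beta$ deleted, $F_r=\det X_r$ for $1\le r\le n+1$ (delete column $r$), $I_n=(F_1,\dots,F_{n+1})$, $R=Q/I_n$. $J^T_Q$ is the $(n+1)\times n(n+1)$ matrix with $(i,(j,l))$-entry $\partial F_i/\partial x_{j,l}$ (columns indexed by the variables in lexicographic order of indices), and $J^T_R=J^T_Q\otimes_QR$. $\mathcal A$: $0\to Q^n\xrightarrow{\varphi_2}Q^{n+1}\xrightarrow{\varphi_1}Q\to0$ with bases $\{T_i\}_{i=1}^n$ of $\mathcal A_2$, $\{e_i\}_{i=1}^{n+1}$ of $\mathcal A_1$, $\{1\}$ of $\mathcal A_0$; $\varphi_1(e_i)=(-1)^{i+1}F_i$, $\varphi_2=X^T$, i.e. $\varphi_2(T_i)=\sum_{\ell=1}^{n+1}x_{i,\ell}e_\ell$. Its dg algebra multiplication: $e_ie_j=-e_je_i=\sum_{k=1}^n(-1)^{i+j+k}\det X^k_{i,j}\,T_k$ for $i<j$, $e_ie_i=0$, $e_iT_j=0$, $T_iT_j=0$. $\mathcal U$: $0\to Q^{(n-1)(n+1)}\xrightarrow{\partial_2}Q^{n(n+1)}\xrightarrow{J^T_Q}Q^{n+1}\to0$ with bases $\{a_i\}_{1\le i\le n+1}$ of $\mathcal U_0$, $\{b_{j,k}\}_{1\le j\le n,1\le k\le n+1}$ of $\mathcal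 U_1$, $\{c_{i,j}\}_{1\le i,j\le n,(i,j)\ne(1,1)}$ of $\mathcal U_2$, with the convention $c_{1,1}=0$; $\partial(b_{i,j})=\sum_{\ell=1}^{n+1}\frac{\partial F_\ell}{\partial x_{i,j}}a_\ell$ and $\partial(c_{i,j})=\sum_{\ell=1}^{n+1}x_{i,\ell}b_{j,\ell}-\delta_{i,j}\sum_{k=1}^{n+1}x_{1,k}b_{1,k}$, where $\delta_{i,j}$ is the Kronecker delta. A dg $\mathcal A$-module structure on $\mathcal U$ is a unitary, associative multiplication $\mathcal A\otimes_Q\mathcal U\to\mathcal U$ with $\mathcal A_i\mathcal U_j\subseteq\mathcal U_{i+j}$ and $\partial^{\mathcal U}(au)=\partial^{\mathcal A}(a)u+(-1)^{i}a\,\partial^{\mathcal U}(u)$ for $a\in\mathcal A_i$, $u\in\mathcal U_j$. *)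

theory Defs
  imports
    "HOL-Library.Poly_Mapping"
    "HOL-Algebra.Module"
    "Jordan_Normal_Form.Determinant"
    "Jordan_Normal_Form.DL_Submatrix"
begin

section \<open>Dg algebras and dg modules over a commutative ring\<close>

text \<open>
  A nonnegatively graded complex is given by its total module \<open>M\<close>, the homogeneous
  components \<open>gr i\<close> and the differential \<open>d\<close> of degree \<open>-1\<close> (zero on degree 0).
\<close>

locale dg_complex = Module.module Q M
  for Q :: "('r, 'q) ring_scheme" (structure)
    and M :: "('r, 'm, 'w) module_scheme" (structure)
    and gr :: "nat \<Rightarrow> 'm set"
    and d :: "'m \<Rightarrow> 'm" +
  assumes gr_submodule: "submodule (gr i) Q M"
    and gr_decomp: "x \<in> carrier M \<Longrightarrow>
      \<exists>!f. (\<forall>i. f i \<in> gr i) \<and> finite {i. f i \<noteq> \<zero>\<^bsub>M\<^esub>} \<and>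
           x = finsum M f {i. f i \<noteq> \<zero>\<^bsub>M\<^esub>}"
    and d_closed: "x \<in> carrier M \<Longrightarrow> d x \<in> carrier M"
    and d_add: "\<lbrakk>x \<in> carrier M; y \<in> carrier M\<rbrakk> \<Longrightarrow> d (x \<oplus>\<^bsub>M\<^esub> y) = d x \<oplus>\<^bsub>M\<^esub> d y"
    and d_smult: "\<lbrakk>q \<in> carrier Q; x \<in> carrier M\<rbrakk> \<Longrightarrow> d (q \<odot>\<^bsub>M\<^esub> x) = q \<odot>\<^bsub>M\<^esub> d x"
    and d_degree: "x \<in> gr (Suc i) \<Longrightarrow> d x \<in> gr i"
    and d_degree_0: "x \<in> gr 0 \<Longrightarrow> d x = \<zero>\<^bsub>M\<^esub>"
    and d_d: "x \<in> carrier M \<Longrightarrow> d (d x) = \<zero>\<^bsub>M\<^esub>"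

text \<open>
  The multiplication and unit of the algebra are the ring operations of the record \<open>A\<close>;
  HOL-Algebra's \<open>ring\<close> is associative and unital but not necessarily commutative.
\<close>

locale dg_algebra = dg_complex Q A grA dA + A: ring A
  for Q :: "('r, 'q) ring_scheme" (structure)
    and A :: "('r, 'a, 'v) module_scheme" (structure)
    and grA :: "nat \<Rightarrow> 'a set"
    and dA :: "'a \<Rightarrow> 'a" +
  assumes mult_smult_left: "\<lbrakk>q \<in> carrier Q; x \<in> carrier A; y \<in> carrier A\<rbrakk> \<Longrightarrow>
      (q \<odot>\<^bsub>A\<^esub> x) \<otimes>\<^bsub>A\<^esub> y = q \<odot>\<^bsub>A\<^esub> (x \<otimes>\<^bsub>A\<^esub> y)"
    and mult_smult_right: "\<lbrakk>q \<in> carrier Q; x \<in> carrier A; y \<in> carrier A\<rbrakk> \<Longrightarrow>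
      x \<otimes>\<^bsub>A\<^esub> (q \<odot>\<^bsub>A\<^esub> y) = q \<odot>\<^bsub>A\<^esub> (x \<otimes>\<^bsub>A\<^esub> y)"
    and one_degree: "\<one>\<^bsub>A\<^esub> \<in> grA 0"
    and mult_degree: "\<lbrakk>x \<in> grA i; y \<in> grA j\<rbrakk> \<Longrightarrow> x \<otimes>\<^bsub>A\<^esub> y \<in> grA (i + j)"
    and mult_leibniz: "\<lbrakk>x \<in> grA i; y \<in> grA j\<rbrakk> \<Longrightarrow>
      dA (x \<otimes>\<^bsub>A\<^esub> y) =
        (dA x \<otimes>\<^bsub>A\<^esub> y) \<oplus>\<^bsub>A\<^esub> (((\<ominus>\<^bsub>Q\<^esub> \<one>\<^bsub>Q\<^esub>) [^]\<^bsub>Q\<^esub> i) \<odot>\<^bsub>A\<^esub> (x \<otimes>\<^bsub>A\<^esub> dA y))"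

text \<open>\<open>act\<close> is a \<open>Q\<close>-bilinear map, i.e. a map on the tensor product of \<open>A\<close> and \<open>U\<close>.\<close>

locale dg_module = dg_algebra Q A grA dA + U: dg_complex Q U grU dU
  for Q :: "('r, 'q) ring_scheme" (structure)
    and A :: "('r, 'a, 'v) module_scheme" (structure)
    and grA :: "nat \<Rightarrow> 'a set"
    and dA :: "'a \<Rightarrow> 'a"
    and U :: "('r, 'u, 'w) module_scheme" (structure)
    and grU :: "nat \<Rightarrow> 'u set"
    and dU :: "'u \<Rightarrow> 'u"
    and act :: "'a \<Rightarrow> 'u \<Rightarrow> 'u" +
  assumes act_closed: "\<lbrakk>x \<in> carrier A; u \<in> carrier U\<rbrakk> \<Longrightarrow> act x u \<in> carrier U"
    and act_add_left: "\<lbrakk>x \<in> carrier A; y \<in> carrier A; u \<in> carrier U\<rbrakk> \<Longrightarrow>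
      act (x \<oplus>\<^bsub>A\<^esub> y) u = act x u \<oplus>\<^bsub>U\<^esub> act y u"
    and act_add_right: "\<lbrakk>x \<in> carrier A; u \<in> carrier U; v \<in> carrier U\<rbrakk> \<Longrightarrow>
      act x (u \<oplus>\<^bsub>U\<^esub> v) = act x u \<oplus>\<^bsub>U\<^esub> act x v"
    and act_smult_left: "\<lbrakk>q \<in> carrier Q; x \<in> carrier A; u \<in> carrier U\<rbrakk> \<Longrightarrow>
      act (q \<odot>\<^bsub>A\<^esub> x) u = q \<odot>\<^bsub>U\<^esub> act x u"
    and act_smult_right: "\<lbrakk>q \<in> carrier Q; x \<in> carrier A; u \<in> carrier U\<rbrakk> \<Longrightarrow>
      act x (q \<odot>\<^bsub>U\<^esub> u) = q \<odot>\<^bsub>U\<^esub> act x u"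
    and act_one: "u \<in> carrier U \<Longrightarrow> act \<one>\<^bsub>A\<^esub> u = u"
    and act_assoc: "\<lbrakk>x \<in> carrier A; y \<in> carrier A; u \<in> carrier U\<rbrakk> \<Longrightarrow>
      act (x \<otimes>\<^bsub>A\<^esub> y) u = act x (act y u)"
    and act_degree: "\<lbrakk>x \<in> grA i; u \<in> grU j\<rbrakk> \<Longrightarrow> act x u \<in> grU (i + j)"
    and act_leibniz: "\<lbrakk>x \<in> grA i; u \<in> grU j\<rbrakk> \<Longrightarrow>
      dU (act x u) =
        act (dA x) u \<oplus>\<^bsub>U\<^esub> (((\<ominus>\<^bsub>Q\<^esub> \<one>\<^bsub>Q\<^esub>) [^]\<^bsub>Q\<^esub> i) \<odot>\<^bsub>U\<^esub> act x (dU u))"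

section \<open>The polynomial ring, the generic matrix and its maximal minors\<close>

text \<open>
  Polynomials are finitely supported functions from monomials to coefficients, where a
  monomial is a finitely supported exponent function on the indices \<open>(i, j)\<close> of the
  variables. The type has a variable for every pair of naturals; \<open>Q_ring n\<close> is the
  polynomial ring in the \<open>x\<^sub>i\<^sub>j\<close> with \<open>1 \<le> i \<le> n\<close> and \<open>1 \<le> j \<le> n + 1\<close>.
\<close>

type_synonym 'k xpoly = "(nat \<times> nat \<Rightarrow>\<^sub>0 nat) \<Rightarrow>\<^sub>0 'k"

definition xvar :: "nat \<Rightarrow> nat \<Rightarrow> 'k::comm_ring_1 xpoly" where
  "xvar i j = Poly_Mapping.single (Poly_Mapping.single (i, j) 1) 1"

definition Q_carrier :: "nat \<Rightarrow> 'k::comm_ring_1 xpoly set" where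
  "Q_carrier n = {p. \<forall>m \<in> Poly_Mapping.keys p. Poly_Mapping.keys m \<subseteq> {1..n} \<times> {1..n+1}}"

definition Q_ring :: "nat \<Rightarrow> 'k::comm_ring_1 xpoly ring" where
  "Q_ring n = \<lparr>carrier = Q_carrier n, mult = (*), one = 1, zero = 0, add = (+)\<rparr>"

definition pdiff :: "nat \<times> nat \<Rightarrow> 'k::comm_ring_1 xpoly \<Rightarrow> 'k xpoly" where
  "pdiff v p = (\<Sum>m \<in> Poly_Mapping.keys p.
     Poly_Mapping.single (m - Poly_Mapping.single v 1)
       (of_nat (Poly_Mapping.lookup m v) * Poly_Mapping.lookup p m))"

text \<open>
  Matrices of \<open>Jordan_Normal_Form\<close> are indexed from 0; in \<open>xvar\<close>, \<open>X_del\<close> and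
  everything below, rows and columns are numbered from 1.
\<close>

definition X_mat :: "nat \<Rightarrow> 'k::comm_ring_1 xpoly mat" where
  "X_mat n = mat n (n + 1) (\<lambda>(i, j). xvar (i + 1) (j + 1))"

text \<open>\<open>X_del n \<alpha> \<beta>\<close> has the columns in \<open>\<alpha>\<close> and the rows in \<open>\<beta>\<close> deleted.\<close>

definition X_del :: "nat \<Rightarrow> nat set \<Rightarrow> nat set \<Rightarrow> 'k::comm_ring_1 xpoly mat" where
  "X_del n \<alpha> \<beta> = submatrix (X_mat n) {i. i + 1 \<notin> \<beta>} {j. j + 1 \<notin> \<alpha>}"

definition F_minor :: "nat \<Rightarrow> nat \<Rightarrow> 'k::comm_ring_1 xpoly" where
  "F_minor n r = det (X_del n {r} {})"

section \<open>Free modules on graded bases\<close>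

text \<open>
  The free module on a set \<open>B\<close> of basis labels consists of the finitely supported
  coefficient functions on \<open>B\<close>.
\<close>

definition scale :: "'k::comm_ring_1 xpoly \<Rightarrow> ('b \<Rightarrow>\<^sub>0 'k xpoly) \<Rightarrow> ('b \<Rightarrow>\<^sub>0 'k xpoly)"
    (infixr \<open>*\<^sub>Q\<close> 75) where
  "q *\<^sub>Q f = Poly_Mapping.map ((*) q) f"

definition basis_elt :: "'b \<Rightarrow> ('b \<Rightarrow>\<^sub>0 'k::comm_ring_1 xpoly)" where
  "basis_elt b = Poly_Mapping.single b 1"

definition free_carrier :: "nat \<Rightarrow> 'b set \<Rightarrow> ('b \<Rightarrow>\<^sub>0 'k::comm_ring_1 xpoly) set" where
  "free_carrier n B =
     {f. Poly_Mapping.keys f \<subseteq> B \<and> (\<forall>b. Poly_Mapping.lookup f b \<in> Q_carrier n)}"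

definition free_gr ::
    "nat \<Rightarrow> 'b set \<Rightarrow> ('b \<Rightarrow> nat) \<Rightarrow> nat \<Rightarrow> ('b \<Rightarrow>\<^sub>0 'k::comm_ring_1 xpoly) set" where
  "free_gr n B deg i = free_carrier n {b \<in> B. deg b = i}"

definition lin_ext ::
    "('b \<Rightarrow> ('c \<Rightarrow>\<^sub>0 'k::comm_ring_1 xpoly)) \<Rightarrow> ('b \<Rightarrow>\<^sub>0 'k xpoly) \<Rightarrow> ('c \<Rightarrow>\<^sub>0 'k xpoly)" where
  "lin_ext h f = (\<Sum>b \<in> Poly_Mapping.keys f. Poly_Mapping.lookup f b *\<^sub>Q h b)"

section \<open>The Hilbert-Burch dg algebra\<close>

datatype A_label = One_lab | E_lab nat | T_lab nat

fun A_deg :: "A_label \<Rightarrow> nat" where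
  "A_deg One_lab = 0"
| "A_deg (E_lab _) = 1"
| "A_deg (T_lab _) = 2"

definition A_basis :: "nat \<Rightarrow> A_label set" where
  "A_basis n = {One_lab} \<union> E_lab ` {1..n+1} \<union> T_lab ` {1..n}"

type_synonym 'k A_type = "A_label \<Rightarrow>\<^sub>0 'k xpoly"

abbreviation A_one :: "'k::comm_ring_1 A_type" where
  "A_one \<equiv> basis_elt One_lab"

abbreviation eA :: "nat \<Rightarrow> 'k::comm_ring_1 A_type" where
  "eA i \<equiv> basis_elt (E_lab i)"

abbreviation TA :: "nat \<Rightarrow> 'k::comm_ring_1 A_type" where
  "TA i \<equiv> basis_elt (T_lab i)"

fun A_diff_basis :: "nat \<Rightarrow> A_label \<Rightarrow> 'k::comm_ring_1 A_type" where
  "A_diff_basis n One_lab = 0"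
| "A_diff_basis n (E_lab i) = ((-1) ^ (i + 1) * F_minor n i) *\<^sub>Q A_one"
| "A_diff_basis n (T_lab i) = (\<Sum>l = 1..n+1. xvar i l *\<^sub>Q eA l)"

definition A_diff :: "nat \<Rightarrow> 'k::comm_ring_1 A_type \<Rightarrow> 'k A_type" where
  "A_diff n = lin_ext (A_diff_basis n)"

text \<open>The product of \<open>e\<^sub>i\<close> and \<open>e\<^sub>j\<close> in the case \<open>i < j\<close>.\<close>

definition ee :: "nat \<Rightarrow> nat \<Rightarrow> nat \<Rightarrow> 'k::comm_ring_1 A_type" where
  "ee n i j = (\<Sum>k = 1..n. ((-1) ^ (i + j + k) * det (X_del n {i, j} {k})) *\<^sub>Q TA k)"

fun A_mult_basis :: "nat \<Rightarrow> A_label \<Rightarrow> A_label \<Rightarrow> 'k::comm_ring_1 A_type" where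
  "A_mult_basis n One_lab y = basis_elt y"
| "A_mult_basis n x One_lab = basis_elt x"
| "A_mult_basis n (E_lab i) (E_lab j) =
     (if i < j then ee n i j else if j < i then - ee n j i else 0)"
| "A_mult_basis n (E_lab i) (T_lab j) = 0"
| "A_mult_basis n (T_lab i) (E_lab j) = 0"
| "A_mult_basis n (T_lab i) (T_lab j) = 0"

definition A_mult :: "nat \<Rightarrow> 'k::comm_ring_1 A_type \<Rightarrow> 'k A_type \<Rightarrow> 'k A_type" where
  "A_mult n f g = lin_ext (\<lambda>x. lin_ext (A_mult_basis n x) g) f"

definition A_alg :: "nat \<Rightarrow> ('k::comm_ring_1 xpoly, 'k A_type) module" where
  "A_alg n = \<lparr>carrier = free_carrier n (A_basis n), mult = A_mult n, one = A_one,
              zero = 0, add = (+), module.smult = (*\<^sub>Q)\<rparr>"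

definition A_gr :: "nat \<Rightarrow> nat \<Rightarrow> 'k::comm_ring_1 A_type set" where
  "A_gr n = free_gr n (A_basis n) A_deg"

section \<open>The complex \<open>\<U>\<close>\<close>

datatype U_label = a_lab nat | b_lab nat nat | c_lab nat nat

fun U_deg :: "U_label \<Rightarrow> nat" where
  "U_deg (a_lab _) = 0"
| "U_deg (b_lab _ _) = 1"
| "U_deg (c_lab _ _) = 2"

definition U_basis :: "nat \<Rightarrow> U_label set" where
  "U_basis n =
     a_lab ` {1..n+1} \<union>
     {b_lab j k |j k. j \<in> {1..n} \<and> k \<in> {1..n+1}} \<union>
     {c_lab i j |i j. i \<in> {1..n} \<and> j \<in> {1..n} \<and> (i, j) \<noteq> (1, 1)}"

type_synonym 'k U_type = "U_label \<Rightarrow>\<^sub>0 'k xpoly"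

abbreviation aU :: "nat \<Rightarrow> 'k::comm_ring_1 U_type" where
  "aU i \<equiv> basis_elt (a_lab i)"

abbreviation bU :: "nat \<Rightarrow> nat \<Rightarrow> 'k::comm_ring_1 U_type" where
  "bU j k \<equiv> basis_elt (b_lab j k)"

text \<open>The label \<open>c_lab 1 1\<close> is not a basis label; \<open>cU 1 1\<close> is zero by convention.\<close>

definition cU :: "nat \<Rightarrow> nat \<Rightarrow> 'k::comm_ring_1 U_type" where
  "cU i j = (if (i, j) = (1, 1) then 0 else basis_elt (c_lab i j))"

fun U_diff_basis :: "nat \<Rightarrow> U_label \<Rightarrow> 'k::comm_ring_1 U_type" where
  "U_diff_basis n (a_lab i) = 0"
| "U_diff_basis n (b_lab i j) = (\<Sum>l = 1..n+1. pdiff (i, j) (F_minor n l) *\<^sub>Q aU l)"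
| "U_diff_basis n (c_lab i j) =
     (\<Sum>l = 1..n+1. xvar i l *\<^sub>Q bU j l) -
     (if i = j then (\<Sum>k = 1..n+1. xvar 1 k *\<^sub>Q bU 1 k) else 0)"

definition U_diff :: "nat \<Rightarrow> 'k::comm_ring_1 U_type \<Rightarrow> 'k U_type" where
  "U_diff n = lin_ext (U_diff_basis n)"

text \<open>Only the module part of the record is meaningful; \<open>\<U>\<close> carries no ring structure.\<close>

definition U_mod :: "nat \<Rightarrow> ('k::comm_ring_1 xpoly, 'k U_type) module" where
  "U_mod n = \<lparr>carrier = free_carrier n (U_basis n), mult = undefined, one = undefined,
              zero = 0, add = (+), module.smult = (*\<^sub>Q)\<rparr>"

definition U_gr :: "nat \<Rightarrow> nat \<Rightarrow> 'k::comm_ring_1 U_type set" where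
  "U_gr n = free_gr n (U_basis n) U_deg"

end

theory Submission
  imports Defs
begin

text \<open>
  All structure constants are cofactors of one family of matrices. Let \<open>M\<^sub>i\<close> be the square matrix
  obtained from \<open>X\<close> by adding the \<open>i\<close>-th unit row on top. Its determinant is the signed minor
  \<open>f\<^sub>i = (-1)\<^sup>i\<^sup>+\<^sup>1 F\<^sub>i\<close>. The cofactor at column \<open>j\<close> of the unit row is \<open>f\<^sub>j\<close>, and the cofactor at column
  \<open>j\<close> of row \<open>k\<close> of \<open>X\<close> is \<open>D\<^sub>i\<^sub>k\<^sub>j = \<partial>f\<^sub>i/\<partial>x\<^sub>k\<^sub>j\<close>, because the determinant is linear in row \<open>k\<close>. Being
  the determinant of \<open>X\<close> with row \<open>k\<close> replaced by the \<open>j\<close>-th unit row and the \<open>i\<close>-th unit row on top,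
  \<open>D\<^sub>i\<^sub>k\<^sub>j\<close> is antisymmetric in \<open>i\<close> and \<open>j\<close>. Comparing \<open>M\<^sub>i adj M\<^sub>i\<close> and \<open>adj M\<^sub>i M\<^sub>i\<close> with \<open>f\<^sub>i\<close> times the
  identity gives
    \<open>\<Sum>\<^sub>l x\<^sub>k\<^sub>l f\<^sub>l = 0\<close>,  \<open>\<Sum>\<^sub>l x\<^sub>k\<^sub>l D\<^sub>i\<^sub>m\<^sub>l = \<delta>\<^sub>k\<^sub>m f\<^sub>i\<close>,  \<open>\<Sum>\<^sub>k D\<^sub>i\<^sub>k\<^sub>j x\<^sub>k\<^sub>l = \<delta>\<^sub>j\<^sub>l f\<^sub>i - \<delta>\<^sub>i\<^sub>l f\<^sub>j\<close>,
  and by antisymmetry \<open>\<Sum>\<^sub>l D\<^sub>l\<^sub>m\<^sub>i x\<^sub>k\<^sub>l = -\<delta>\<^sub>k\<^sub>m f\<^sub>i\<close> (lemmas \<open>sum_xvar_signed_minor\<close>,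
  \<open>sum_xvar_minor_deriv\<close>, \<open>sum_minor_deriv_xvar_rows\<close> and \<open>sum_minor_deriv_xvar_border\<close>).
  
  In these terms the products lose their case distinctions. With \<open>w = \<Sum>\<^sub>k x\<^sub>1\<^sub>k b\<^sub>1\<^sub>k\<close> they are
    \<open>e\<^sub>i e\<^sub>j = \<Sum>\<^sub>k D\<^sub>i\<^sub>k\<^sub>j T\<^sub>k\<close>,  \<open>e\<^sub>i b\<^sub>j\<^sub>k = \<Sum>\<^sub>l D\<^sub>i\<^sub>l\<^sub>k c\<^sub>l\<^sub>j\<close>,  \<open>e\<^sub>i a\<^sub>j = (-1)\<^sup>j (\<Sum>\<^sub>k x\<^sub>k\<^sub>j b\<^sub>k\<^sub>i - \<delta>\<^sub>i\<^sub>j w)\<close>.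
  Each instance of associativity or of the Leibniz rule on basis elements then reduces to
  interchanging two sums and applying one of the four identities. The term \<open>w\<close> matches the \<open>w\<close> in
  \<open>\<partial>(c\<^sub>i\<^sub>j)\<close>, and \<open>e\<^sub>i w = f\<^sub>i c\<^sub>1\<^sub>1 = 0\<close> keeps it out of the products with \<open>e\<^sub>i\<close>. Since all axioms are
  multilinear, the locale \<open>dg_action\<close> reduces them to basis elements, for \<open>\<A>\<close> acting on itself as
  well as for \<open>\<A>\<close> acting on \<open>\<U>\<close>.
\<close>

declare sum.cl_ivl_Suc [simp del] sum.lessThan_Suc [simp del] sum.atMost_Suc [simp del]

section \<open>Submatrices and cofactors of the bordered generic matrix\<close>

text \<open>
  An increasing enumeration is determined by its range. This turns the index selection in
  \<open>submatrix\<close> into compositions of \<open>insert_index\<close>, the index map of \<open>mat_delete\<close>.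
\<close>

lemma pick_range:
  fixes f :: "nat \<Rightarrow> nat"
  assumes "strict_mono f"
  shows "pick (range f) i = f i"
proof (induction i)
  case 0
  show ?case
    using strict_mono_less_eq[OF assms] by (auto intro!: Least_equality)
next
  case (Suc i)
  have "(LEAST a. a \<in> range f \<and> f i < a) = f (Suc i)"
    using strict_mono_less[OF assms] strict_mono_less_eq[OF assms]
    by (intro Least_equality) auto
  then show ?case using Suc by simp
qed

lemma strict_mono_insert_index: "strict_mono (insert_index a)"
  by (rule strict_monoI) (auto simp: insert_index_def)

lemma strict_mono_id: "strict_mono (id :: nat \<Rightarrow> nat)"
  by (simp add: strict_mono_def)

lemma range_insert_index: "range (insert_index a) = - {a}"
proof -
  have "i \<in> range (insert_index a)" if "i \<noteq> a" for i
    using insert_delete_index[OF that] by (metis rangeI)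
  then show ?thesis by auto
qed

lemma range_insert_index2:
  "range (\<lambda>c. insert_index a (insert_index b c)) = - {a, insert_index a b}"
proof -
  have "range (\<lambda>c. insert_index a (insert_index b c)) = insert_index a ` (- {b})"
    by (simp add: image_image flip: range_insert_index)
  also have "\<dots> = range (insert_index a) - insert_index a ` {b}"
    using image_set_diff[OF insert_index_inj_on, of a UNIV "{b}"] by (simp add: Compl_eq_Diff_UNIV)
  finally show ?thesis by (auto simp: range_insert_index)
qed

lemma card_deleted_indices:
  assumes "A \<subseteq> {..<m}"
  shows "card {i. i < m \<and> i \<notin> A} = m - card A"
proof -
  have "{i. i < m \<and> i \<notin> A} = {..<m} - A" by auto
  then show ?thesis using assms by (simp add: card_Diff_subset finite_subset)
qed

lemma submatrix_ranges:
  assumes "strict_mono f" "strict_mono g"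
    and "range f = - I" "I \<subseteq> {..<dim_row A}" "range g = - J" "J \<subseteq> {..<dim_col A}"
  shows "submatrix A (- I) (- J) =
    mat (dim_row A - card I) (dim_col A - card J) (\<lambda>(i, j). A $$ (f i, g j))"
  using pick_range[OF assms(1)] pick_range[OF assms(2)] assms
  unfolding submatrix_def by (simp add: card_deleted_indices)

text \<open>
  The matrix \<open>X\<close> with the \<open>i\<close>-th unit row put on top as row 0, so that row \<open>k\<close> of \<open>X\<close> keeps its
  number \<open>k\<close>; column \<open>l\<close> of \<open>X\<close> is column \<open>l - 1\<close> of the matrix.
\<close>

definition bordered :: "nat \<Rightarrow> nat \<Rightarrow> 'k::comm_ring_1 xpoly mat" where
  "bordered n i = mat (n + 1) (n + 1)
     (\<lambda>(r, c). if r = 0 then (if c + 1 = i then 1 else 0) else xvar r (c + 1))"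

definition signed_minor :: "nat \<Rightarrow> nat \<Rightarrow> 'k::comm_ring_1 xpoly" where
  "signed_minor n l = (-1) ^ (l + 1) * F_minor n l"

text \<open>
  This is \<open>\<partial>f\<^sub>i/\<partial>x\<^sub>k\<^sub>j\<close> for the signed minor \<open>f\<^sub>i\<close>, see \<open>minor_deriv_eq_pdiff\<close>. As a cofactor
  it takes part in the expansions of \<open>det (bordered n i)\<close>.
\<close>

definition minor_deriv :: "nat \<Rightarrow> nat \<Rightarrow> nat \<Rightarrow> nat \<Rightarrow> 'k::comm_ring_1 xpoly" where
  "minor_deriv n i k j = cofactor (bordered n i) k (j - 1)"

lemma bordered_carrier [simp]: "bordered n i \<in> carrier_mat (n + 1) (n + 1)"
  by (simp add: bordered_def)

lemma dim_bordered [simp]: "dim_row (bordered n i) = n + 1" "dim_col (bordered n i) = n + 1"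
  by (simp_all add: bordered_def)

lemma bordered_border:
  "l \<in> {1..n+1} \<Longrightarrow> bordered n i $$ (0, l - 1) = (if l = i then 1 else 0)"
  by (auto simp: bordered_def)

lemma bordered_generic:
  "k \<in> {1..n} \<Longrightarrow> l \<in> {1..n+1} \<Longrightarrow> bordered n i $$ (k, l - 1) = xvar k l"
  by (auto simp: bordered_def)

lemma mat_delete_bordered_border:
  assumes "l \<in> {1..n+1}"
  shows "mat_delete (bordered n i) 0 (l - 1) = (X_del n {l} {} :: 'k::comm_ring_1 xpoly mat)"
proof -
  have col: "{j. j + 1 \<notin> {l}} = - {l - 1}" and l: "l - 1 < n + 1" using assms by auto
  have "(X_del n {l} {} :: 'k xpoly mat) = mat n n (\<lambda>(r, c). X_mat n $$ (r, insert_index (l - 1) c))"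
    using submatrix_ranges[OF strict_mono_id strict_mono_insert_index[of "l - 1"],
        where I = "{}" and J = "{l - 1}" and A = "X_mat n"] l
    unfolding X_del_def col
    by (simp add: X_mat_def range_insert_index)
  also have "\<dots> = mat_delete (bordered n i) 0 (l - 1)"
    using assms by (intro eq_matI) (auto simp: X_mat_def bordered_def mat_delete_def insert_index_def)
  finally show ?thesis by simp
qed

lemma cofactor_border:
  assumes "l \<in> {1..n+1}"
  shows "cofactor (bordered n i) 0 (l - 1) = (signed_minor n l :: 'a::comm_ring_1 xpoly)"
proof -
  have "l + 1 = Suc (Suc (l - 1))" using assms by simp
  then have "(-1) ^ (l + 1) = ((-1) ^ (l - 1) :: 'a xpoly)"
    by (metis power_Suc mult_minus1 minus_minus)
  then show ?thesis
    unfolding cofactor_def mat_delete_bordered_border[OF assms] signed_minor_def F_minor_def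
    by simp
qed

lemma sum_from_1: "(\<Sum>l = 1..m. f l) = (\<Sum>c<m. f (Suc c))" for m :: nat
  by (simp add: sum.atLeast1_atMost_eq)

lemma det_bordered:
  assumes "i \<in> {1..n+1}"
  shows "det (bordered n i) = signed_minor n i"
proof -
  have "det (bordered n i) =
      (\<Sum>c<n+1. bordered n i $$ (0, c) * cofactor (bordered n i) 0 c)"
    by (rule laplace_expansion_row) auto
  also have "\<dots> = (\<Sum>l = 1..n+1. bordered n i $$ (0, l - 1) * cofactor (bordered n i) 0 (l - 1))"
    unfolding sum_from_1 by simp
  also have "\<dots> = (\<Sum>l = 1..n+1. if l = i then signed_minor n l else 0)"
    by (intro sum.cong refl) (simp only: bordered_border cofactor_border, simp)
  also have "\<dots> = signed_minor n i"
    using assms by (simp add: sum.delta)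
  finally show ?thesis .
qed

text \<open>
  The two products of the bordered matrix with its adjugate, read entry by entry, contain all
  linear relations between minors with the variables as coefficients that are needed below.
\<close>

lemma bordered_times_cofactor:
  assumes "r \<le> n" "r' \<le> n" "i \<in> {1..n+1}"
  shows "(\<Sum>l = 1..n+1. bordered n i $$ (r, l - 1) * cofactor (bordered n i) r' (l - 1)) =
    (if r = r' then signed_minor n i else 0)"
proof -
  have "(\<Sum>l = 1..n+1. bordered n i $$ (r, l - 1) * cofactor (bordered n i) r' (l - 1)) =
      (bordered n i * adj_mat (bordered n i)) $$ (r, r')"
    unfolding sum_from_1
    using assms by (simp add: adj_mat_def scalar_prod_def atLeast0LessThan)
  also have "\<dots> = (signed_minor n i \<cdot>\<^sub>m 1\<^sub>m (n + 1)) $$ (r, r')"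
    by (simp only: adj_mat(2)[OF bordered_carrier] det_bordered[OF assms(3)])
  also have "\<dots> = (if r = r' then signed_minor n i else 0)" using assms by simp
  finally show ?thesis .
qed

lemma cofactor_times_bordered:
  assumes "j \<in> {1..n+1}" "l \<in> {1..n+1}" "i \<in> {1..n+1}"
  shows "(\<Sum>r\<le>n. cofactor (bordered n i) r (j - 1) * bordered n i $$ (r, l - 1)) =
    (if j = l then signed_minor n i else 0)"
proof -
  have "j - 1 < n + 1" "l - 1 < n + 1" using assms by auto
  then have "(\<Sum>r\<le>n. cofactor (bordered n i) r (j - 1) * bordered n i $$ (r, l - 1)) =
      (adj_mat (bordered n i) * bordered n i) $$ (j - 1, l - 1)"
    by (simp add: adj_mat_def scalar_prod_def atLeast0LessThan lessThan_Suc_atMost)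
  also have "\<dots> = (signed_minor n i \<cdot>\<^sub>m 1\<^sub>m (n + 1)) $$ (j - 1, l - 1)"
    by (simp only: adj_mat(3)[OF bordered_carrier] det_bordered[OF assms(3)])
  also have "\<dots> = (if j = l then signed_minor n i else 0)"
    using assms by (auto simp: eq_diff_iff)
  finally show ?thesis .
qed

lemma sum_xvar_signed_minor:
  assumes "k \<in> {1..n}"
  shows "(\<Sum>l = 1..n+1. xvar k l * signed_minor n l) = 0"
proof -
  have "(\<Sum>l = 1..n+1. xvar k l * signed_minor n l) =
      (\<Sum>l = 1..n+1. bordered n 1 $$ (k, l - 1) * cofactor (bordered n 1) 0 (l - 1))"
    by (intro sum.cong refl) (simp only: cofactor_border bordered_generic[OF assms])
  also have "\<dots> = 0" using assms by (subst bordered_times_cofactor) auto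
  finally show ?thesis .
qed

lemma sum_xvar_minor_deriv:
  assumes "k \<in> {1..n}" "m \<in> {1..n}" "i \<in> {1..n+1}"
  shows "(\<Sum>l = 1..n+1. xvar k l * minor_deriv n i m l) = (if k = m then signed_minor n i else 0)"
proof -
  have "(\<Sum>l = 1..n+1. xvar k l * minor_deriv n i m l) =
      (\<Sum>l = 1..n+1. bordered n i $$ (k, l - 1) * cofactor (bordered n i) m (l - 1))"
    by (intro sum.cong refl) (simp only: minor_deriv_def bordered_generic[OF assms(1)])
  also have "\<dots> = (if k = m then signed_minor n i else 0)"
    using assms by (intro bordered_times_cofactor) auto
  finally show ?thesis .
qed

text \<open>
  Off-diagonal entry of matrix times adjugate, with the unit row as the row of the matrix.
\<close>

lemma minor_deriv_same:
  assumes "m \<in> {1..n}" "i \<in> {1..n+1}"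
  shows "minor_deriv n i m i = 0"
proof -
  have "minor_deriv n i m i = (\<Sum>l = 1..n+1. if l = i then minor_deriv n i m l else 0)"
    using assms by (simp add: sum.delta)
  also have "\<dots> = (\<Sum>l = 1..n+1. bordered n i $$ (0, l - 1) * cofactor (bordered n i) m (l - 1))"
    by (intro sum.cong refl) (simp only: minor_deriv_def bordered_border, simp)
  also have "\<dots> = (if 0 = m then signed_minor n i else 0)"
    using assms by (intro bordered_times_cofactor) auto
  finally show ?thesis using assms by simp
qed

lemma sum_minor_deriv_xvar_rows:
  assumes "j \<in> {1..n+1}" "l \<in> {1..n+1}" "i \<in> {1..n+1}"
  shows "(\<Sum>k = 1..n. minor_deriv n i k j * xvar k l) =
    (if j = l then signed_minor n i else 0) -
    (if i = l then signed_minor n j else (0 :: 'k::comm_ring_1 xpoly))"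
proof -
  have "(if j = l then signed_minor n i else (0 :: 'k xpoly)) =
      (\<Sum>r\<le>n. cofactor (bordered n i) r (j - 1) * bordered n i $$ (r, l - 1))"
    by (rule cofactor_times_bordered[OF assms, symmetric])
  also have "\<dots> = cofactor (bordered n i) 0 (j - 1) * bordered n i $$ (0, l - 1) +
      (\<Sum>k = 1..n. cofactor (bordered n i) k (j - 1) * bordered n i $$ (k, l - 1))"
    unfolding sum_from_1 by (rule sum.atMost_shift)
  also have "cofactor (bordered n i) 0 (j - 1) * bordered n i $$ (0, l - 1) =
      (if i = l then signed_minor n j else 0)"
    unfolding cofactor_border[OF assms(1)] bordered_border[OF assms(2)] by auto
  also have "(\<Sum>k = 1..n. cofactor (bordered n i) k (j - 1) * bordered n i $$ (k, l - 1)) =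
      (\<Sum>k = 1..n. minor_deriv n i k j * xvar k l)"
    by (intro sum.cong refl) (simp only: minor_deriv_def bordered_generic[OF _ assms(2)])
  finally show ?thesis by simp
qed

text \<open>
  The unit row survives the deletion of row \<open>k\<close> and column \<open>j\<close> as long as \<open>i \<noteq> j\<close>, with its entry 1
  at the position \<open>p\<close> that column \<open>i\<close> takes once column \<open>j\<close> is gone. Expanding along it deletes
  column \<open>i\<close>. The relation between \<open>p\<close> and \<open>i\<close> covers \<open>i < j\<close> and \<open>j < i\<close> at once: \<open>p\<close> is \<open>i - 1\<close> in
  the first case and \<open>i - 2\<close> in the second, and this shift is the sign in the antisymmetry.
\<close>

lemma minor_deriv_eq_det:
  assumes "k \<in> {1..n}" "i \<in> {1..n+1}" "j \<in> {1..n+1}" "p < n" "insert_index (j - 1) p = i - 1"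
  shows "minor_deriv n i k j =
    (-1) ^ (k + (j - 1) + p) * det (X_del n {i, j} {k} :: 'k::comm_ring_1 xpoly mat)"
proof -
  let ?B = "bordered n i :: 'k xpoly mat"
  let ?g = "\<lambda>c. insert_index (j - 1) (insert_index p c)"
  let ?D = "mat_delete ?B k (j - 1)"
  have ne: "i \<noteq> j" using assms(5) insert_index_exclude by metis
  have row: "{r. r + 1 \<notin> {k}} = - {k - 1}" using assms by auto
  have col: "{c. c + 1 \<notin> {i, j}} = - {j - 1, i - 1}" using assms by auto
  have mono: "strict_mono ?g"
    using strict_mono_insert_index by (auto simp: strict_mono_def)
  have rg: "range ?g = - {j - 1, i - 1}" using range_insert_index2[of "j - 1" p] assms(5) by simp
  have "card {j - 1, i - 1} = 2" "k - 1 < n" "j - 1 < n + 1" "i - 1 < n + 1"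
    using ne assms by auto
  then have "(X_del n {i, j} {k} :: 'k xpoly mat) =
      mat (n - 1) (n - 1) (\<lambda>(r, c). X_mat n $$ (insert_index (k - 1) r, ?g c))"
    using submatrix_ranges[of "insert_index (k - 1)" ?g "{k - 1}" "X_mat n" "{j - 1, i - 1}"]
      mono rg
    unfolding X_del_def row col
    by (simp add: X_mat_def strict_mono_insert_index range_insert_index)
  also have "\<dots> = mat_delete ?D 0 p"
    using assms
    by (intro eq_matI) (auto simp: X_mat_def bordered_def mat_delete_def insert_index_def)
  finally have dd: "mat_delete ?D 0 p = X_del n {i, j} {k}" by simp
  have border: "?D $$ (0, c) = (if c = p then 1 else 0)" if "c < n" for c
  proof -
    have "?D $$ (0, c) = (if insert_index (j - 1) c = i - 1 then 1 else 0)"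
      using that assms by (auto simp: bordered_def mat_delete_def insert_index_def)
    then show ?thesis
      unfolding assms(5)[symmetric] inj_eq[OF insert_index_inj_on] .
  qed
  have D: "?D \<in> carrier_mat n n" using mat_delete_carrier[OF bordered_carrier, of n i k "j - 1"] by simp
  have "det ?D = (\<Sum>c<n. ?D $$ (0, c) * cofactor ?D 0 c)"
    using assms by (intro laplace_expansion_row[OF D]) simp
  also have "\<dots> = (\<Sum>c<n. if c = p then cofactor ?D 0 c else 0)"
    by (intro sum.cong refl) (simp only: lessThan_iff border, simp)
  also have "\<dots> = (-1) ^ p * det (X_del n {i, j} {k})"
    using assms dd by (simp add: cofactor_def)
  finally show ?thesis
    by (simp add: minor_deriv_def cofactor_def power_add mult.assoc)
qed

text \<open>
  This identifies the structure constants of the products \<open>e\<^sub>i e\<^sub>j\<close> as derivatives of minors.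
\<close>

lemma minor_deriv_less:
  assumes "k \<in> {1..n}" "i \<in> {1..n+1}" "j \<in> {1..n+1}" "i < j"
  shows "minor_deriv n i k j = (-1) ^ (i + j + k) * det (X_del n {i, j} {k})"
proof -
  have "i - 1 < n" "insert_index (j - 1) (i - 1) = i - 1" using assms by auto
  note eq = minor_deriv_eq_det[OF assms(1-3) this]
  have exp: "i + j + k = Suc (Suc (k + (j - 1) + (i - 1)))" using assms by auto
  show ?thesis unfolding eq exp power_Suc by (simp only: mult_minus1 minus_minus)
qed

lemma minor_deriv_greater:
  assumes "k \<in> {1..n}" "i \<in> {1..n+1}" "j \<in> {1..n+1}" "i < j"
  shows "minor_deriv n j k i = - minor_deriv n i k j"
proof -
  have "j - 2 < n" "insert_index (i - 1) (j - 2) = j - 1" using assms by auto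
  note eq = minor_deriv_eq_det[OF assms(1,3,2) this]
  have exp: "i + j + k = Suc (Suc (Suc (k + (i - 1) + (j - 2))))" using assms by auto
  show ?thesis
    unfolding eq minor_deriv_less[OF assms] exp power_Suc insert_commute[of j i "{}"]
    by (simp only: mult_minus1 minus_minus mult_minus_left mult_1_left)
qed

lemma minor_deriv_antisym:
  assumes "k \<in> {1..n}" "i \<in> {1..n+1}" "j \<in> {1..n+1}"
  shows "minor_deriv n i k j = - minor_deriv n j k i"
proof (cases i j rule: linorder_cases)
  case less
  show ?thesis unfolding minor_deriv_greater[OF assms less] by simp
next
  case equal
  show ?thesis unfolding equal minor_deriv_same[OF assms(1,3)] by simp
next
  case greater
  show ?thesis by (rule minor_deriv_greater[OF assms(1,3,2) greater])
qed

text \<open>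
  Antisymmetry moves the summation index from the unit row to the column of the cofactor, where
  the row expansion applies.
\<close>

lemma sum_minor_deriv_xvar_border:
  assumes "k \<in> {1..n}" "m \<in> {1..n}" "i \<in> {1..n+1}"
  shows "(\<Sum>l = 1..n+1. minor_deriv n l m i * xvar k l) = (if k = m then - signed_minor n i else 0)"
proof -
  have "(\<Sum>l = 1..n+1. minor_deriv n l m i * xvar k l) =
      - (\<Sum>l = 1..n+1. xvar k l * minor_deriv n i m l)"
    unfolding sum_negf[symmetric]
    using assms by (intro sum.cong) (auto simp: minor_deriv_antisym[of m n _ i] mult.commute)
  also have "\<dots> = (if k = m then - signed_minor n i else 0)"
    unfolding sum_xvar_minor_deriv[OF assms] by simp
  finally show ?thesis .
qed

section \<open>Derivatives of the signed minors\<close>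

lemma poly_mapping_add_induct:
  assumes "P 0" "\<And>m c. P (Poly_Mapping.single m c)" "\<And>p q. P p \<Longrightarrow> P q \<Longrightarrow> P (p + q)"
  shows "P p"
proof (induction p rule: Poly_Mapping.update_induct)
  case const
  show ?case by (rule assms(1))
next
  case (update f a b)
  have "Poly_Mapping.update a b f = f + Poly_Mapping.single a b"
    using update(1)
    by (intro poly_mapping_eqI) (auto simp: lookup_update lookup_add lookup_single when_def in_keys_iff)
  then show ?case using assms(2,3) update(3) by simp
qed

lemma pdiff_single:
  "pdiff v (Poly_Mapping.single m c) =
    Poly_Mapping.single (m - Poly_Mapping.single v 1) (of_nat (Poly_Mapping.lookup m v) * c)"
  by (simp add: pdiff_def)

lemma pdiff_0 [simp]: "pdiff v 0 = 0"
  by (simp add: pdiff_def)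

lemma pdiff_add: "pdiff v (p + q) = pdiff v p + pdiff v q"
  unfolding pdiff_def
  by (rule setsum_keys_plus_distrib) (simp_all add: distrib_left single_add)

lemma pdiff_uminus: "pdiff v (- p) = - pdiff v p"
  using pdiff_add[of v p "- p"] by (simp add: eq_neg_iff_add_eq_0 add.commute)

lemma pdiff_sum: "pdiff v (\<Sum>x\<in>A. f x) = (\<Sum>x\<in>A. pdiff v (f x))"
  by (induction A rule: infinite_finite_induct) (simp_all add: pdiff_add)

lemma pdiff_mult: "pdiff v (p * q) = p * pdiff v q + pdiff v p * q"
proof (induction p rule: poly_mapping_add_induct)
  case (2 m c)
  show ?case
  proof (induction q rule: poly_mapping_add_induct)
    case (2 k d)
    let ?v = "Poly_Mapping.single v (1::nat)"
    \<comment> \<open>Subtraction of exponents truncates, so this fails where \<open>v\<close> has exponent 0; there the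
      coefficient is 0.\<close>
    have right: "m + (k - ?v) = m + k - ?v" if "Poly_Mapping.lookup k v \<noteq> 0"
      using that by (intro poly_mapping_eqI) (auto simp: lookup_add lookup_minus lookup_single when_def)
    have left: "(m - ?v) + k = m + k - ?v" if "Poly_Mapping.lookup m v \<noteq> 0"
      using that by (intro poly_mapping_eqI) (auto simp: lookup_add lookup_minus lookup_single when_def)
    show ?case
      using left right
      by (cases "Poly_Mapping.lookup k v = 0"; cases "Poly_Mapping.lookup m v = 0")
        (simp_all add: mult_single pdiff_single lookup_add algebra_simps flip: single_add)
  qed (simp_all add: distrib_left pdiff_add)
qed (simp_all add: distrib_right pdiff_add)

lemma pdiff_1 [simp]: "pdiff v 1 = 0"
  by (simp add: pdiff_def)

lemma pdiff_xvar: "pdiff v (xvar i j) = (if v = (i, j) then 1 else 0)"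
  by (simp add: xvar_def pdiff_single lookup_single)

lemma pdiff_prod_0:
  assumes "\<And>x. x \<in> A \<Longrightarrow> pdiff v (f x) = 0"
  shows "pdiff v (\<Prod>x\<in>A. f x) = 0"
  using assms by (induction A rule: infinite_finite_induct) (simp_all add: pdiff_mult)

lemma pdiff_power_minus_1 [simp]: "pdiff v ((- 1) ^ i) = 0"
  by (induction i) (simp_all add: pdiff_uminus)

lemma pdiff_det_0:
  assumes "\<And>r c. r < dim_row A \<Longrightarrow> c < dim_row A \<Longrightarrow> pdiff v (A $$ (r, c)) = 0"
  shows "pdiff v (det A) = 0"
proof -
  have "pdiff v (signof p * (\<Prod>r = 0..<dim_row A. A $$ (r, p r))) = 0"
    if "p permutes {0..<dim_row A}" for p
  proof -
    have "pdiff v (\<Prod>r = 0..<dim_row A. A $$ (r, p r)) = 0"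
      using permutes_in_image[OF that] by (intro pdiff_prod_0 assms) auto
    then show ?thesis by (cases rule: sign_cases[of p]) (simp_all add: pdiff_uminus)
  qed
  then show ?thesis by (auto simp: det_def pdiff_sum intro!: sum.neutral)
qed

text \<open>
  In the expansion of \<open>det (bordered n l)\<close> along row \<open>j\<close>, no cofactor involves a variable of that
  row, so differentiating by \<open>x\<^sub>j\<^sub>k\<close> picks out the cofactor at column \<open>k\<close>.
\<close>

lemma minor_deriv_eq_pdiff:
  assumes "l \<in> {1..n+1}" "j \<in> {1..n}" "k \<in> {1..n+1}"
  shows "minor_deriv n l j k = pdiff (j, k) (signed_minor n l :: 'k::comm_ring_1 xpoly)"
proof -
  let ?B = "bordered n l :: 'k xpoly mat"
  have cof: "pdiff (j, k) (cofactor ?B j c) = 0" for c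
    unfolding cofactor_def pdiff_mult
    by (subst pdiff_det_0) (auto simp: mat_delete_def bordered_def pdiff_xvar)
  have entry: "pdiff (j, k) (?B $$ (j, c - 1)) = (if c = k then 1 else 0)" if "c \<in> {1..n+1}" for c
    unfolding bordered_generic[OF assms(2) that] by (auto simp: pdiff_xvar)
  have "signed_minor n l = (\<Sum>c<n+1. ?B $$ (j, c) * cofactor ?B j c)"
    using assms(2) unfolding det_bordered[OF assms(1), symmetric]
    by (intro laplace_expansion_row) auto
  also have "\<dots> = (\<Sum>c = 1..n+1. ?B $$ (j, c - 1) * cofactor ?B j (c - 1))"
    unfolding sum_from_1 by simp
  finally have "pdiff (j, k) (signed_minor n l) =
      (\<Sum>c = 1..n+1. pdiff (j, k) (?B $$ (j, c - 1)) * cofactor ?B j (c - 1))"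
    by (simp only: pdiff_sum pdiff_mult cof mult_zero_right add_0_left)
  also have "\<dots> = (\<Sum>c = 1..n+1. if c = k then cofactor ?B j (c - 1) else 0)"
    by (intro sum.cong refl) (simp only: entry, simp)
  also have "\<dots> = minor_deriv n l j k"
    using assms by (simp add: minor_deriv_def sum.delta)
  finally show ?thesis by simp
qed

lemma pdiff_F_minor:
  assumes "l \<in> {1..n+1}" "j \<in> {1..n}" "k \<in> {1..n+1}"
  shows "pdiff (j, k) (F_minor n l :: 'k::comm_ring_1 xpoly) =
    (-1) ^ (l + 1) * minor_deriv n l j k"
proof -
  have "(F_minor n l :: 'k xpoly) = (-1) ^ (l + 1) * signed_minor n l"
    by (simp add: signed_minor_def flip: mult.assoc power_add)
  then show ?thesis
    by (simp add: pdiff_mult minor_deriv_eq_pdiff[OF assms] pdiff_uminus)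
qed

section \<open>The polynomial ring of the generic matrix\<close>

lemma Q_carrier_0 [simp]: "0 \<in> Q_carrier n"
  by (simp add: Q_carrier_def)

lemma Q_carrier_1 [simp]: "1 \<in> Q_carrier n"
  by (simp add: Q_carrier_def)

lemma Q_carrier_add [simp]: "p \<in> Q_carrier n \<Longrightarrow> q \<in> Q_carrier n \<Longrightarrow> p + q \<in> Q_carrier n"
  using Poly_Mapping.keys_add[of p q] by (fastforce simp: Q_carrier_def)

lemma Q_carrier_uminus [simp]: "p \<in> Q_carrier n \<Longrightarrow> - p \<in> Q_carrier n"
  by (simp add: Q_carrier_def)

lemma Q_carrier_mult [simp]:
  assumes "p \<in> Q_carrier n" "q \<in> Q_carrier n"
  shows "p * q \<in> Q_carrier n"
proof -
  have "Poly_Mapping.keys m \<subseteq> {1..n} \<times> {1..n+1}" if m: "m \<in> Poly_Mapping.keys (p * q)" for m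
  proof -
    obtain a b where "m = a + b" "a \<in> Poly_Mapping.keys p" "b \<in> Poly_Mapping.keys q"
      using m Poly_Mapping.keys_mult[of p q] by auto
    then show ?thesis
      using assms Poly_Mapping.keys_add[of a b] unfolding Q_carrier_def by blast
  qed
  then show ?thesis by (simp add: Q_carrier_def)
qed

lemma Q_carrier_sum: "(\<And>x. x \<in> A \<Longrightarrow> f x \<in> Q_carrier n) \<Longrightarrow> (\<Sum>x\<in>A. f x) \<in> Q_carrier n"
  by (induction A rule: infinite_finite_induct) simp_all

lemma Q_carrier_prod: "(\<And>x. x \<in> A \<Longrightarrow> f x \<in> Q_carrier n) \<Longrightarrow> (\<Prod>x\<in>A. f x) \<in> Q_carrier n"
  by (induction A rule: infinite_finite_induct) simp_all

lemma Q_carrier_power_minus_1 [simp]: "(-1) ^ i \<in> Q_carrier n"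
  by (induction i) simp_all

lemma Q_carrier_xvar [simp]: "i \<in> {1..n} \<Longrightarrow> j \<in> {1..n+1} \<Longrightarrow> xvar i j \<in> Q_carrier n"
  by (simp add: Q_carrier_def xvar_def)

lemma Q_carrier_det:
  assumes "\<And>r c. r < dim_row A \<Longrightarrow> c < dim_row A \<Longrightarrow> A $$ (r, c) \<in> Q_carrier n"
  shows "det A \<in> Q_carrier n"
proof -
  have "signof p * (\<Prod>r = 0..<dim_row A. A $$ (r, p r)) \<in> Q_carrier n"
    if "p permutes {0..<dim_row A}" for p
  proof -
    have "(\<Prod>r = 0..<dim_row A. A $$ (r, p r)) \<in> Q_carrier n"
      using permutes_in_image[OF that] by (intro Q_carrier_prod assms) auto
    then show ?thesis by (cases rule: sign_cases[of p]) simp_all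
  qed
  then show ?thesis by (auto simp: det_def intro!: Q_carrier_sum)
qed

lemma Q_carrier_cofactor_bordered: "cofactor (bordered n i) r c \<in> Q_carrier n"
  unfolding cofactor_def
  by (intro Q_carrier_mult Q_carrier_det) (auto simp: mat_delete_def bordered_def)

lemma Q_carrier_minor_deriv [simp]: "minor_deriv n i k j \<in> Q_carrier n"
  unfolding minor_deriv_def by (rule Q_carrier_cofactor_bordered)

lemma Q_carrier_signed_minor [simp]: "l \<in> {1..n+1} \<Longrightarrow> signed_minor n l \<in> Q_carrier n"
  using Q_carrier_cofactor_bordered cofactor_border by metis

lemma Q_ring_simps [simp]:
  "carrier (Q_ring n) = Q_carrier n" "mult (Q_ring n) = (*)" "one (Q_ring n) = 1"
  "zero (Q_ring n) = 0" "add (Q_ring n) = (+)"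
  by (simp_all add: Q_ring_def)

lemma cring_Q_ring: "cring (Q_ring n)"
proof (intro cringI abelian_groupI comm_monoidI)
  fix p :: "'k::comm_ring_1 xpoly" assume "p \<in> carrier (Q_ring n)"
  then show "\<exists>q \<in> carrier (Q_ring n). q \<oplus>\<^bsub>Q_ring n\<^esub> p = \<zero>\<^bsub>Q_ring n\<^esub>"
    by (intro bexI[of _ "- p"]) simp_all
qed (simp_all add: algebra_simps)

lemma Q_ring_power_minus_1:
  "(\<ominus>\<^bsub>Q_ring n\<^esub> \<one>\<^bsub>Q_ring n\<^esub>) [^]\<^bsub>Q_ring n\<^esub> (i::nat) = ((-1) ^ i :: 'k::comm_ring_1 xpoly)"
proof -
  interpret cring "Q_ring n :: 'k xpoly ring" by (rule cring_Q_ring)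
  have "\<ominus>\<^bsub>Q_ring n\<^esub> \<one>\<^bsub>Q_ring n\<^esub> = (-1 :: 'k xpoly)"
    using minus_equality[of "-1" "1"] by simp
  then show ?thesis by (induction i) (simp_all add: nat_pow_def)
qed

section \<open>Linear maps between free modules\<close>

lemma lookup_scale [simp]: "Poly_Mapping.lookup (q *\<^sub>Q f) b = q * Poly_Mapping.lookup f b"
  unfolding scale_def by (subst Poly_Mapping.map.rep_eq) (simp add: when_def)

lemma lookup_basis_elt: "Poly_Mapping.lookup (basis_elt b) c = (if b = c then 1 else 0)"
  by (simp add: basis_elt_def lookup_single when_def)

text \<open>
  The free module on all labels is a module in the type-class sense, which supplies the rules for
  scalars, sums and homomorphisms. Linear maps are treated on the whole type; the carriers of the
  module records enter only through \<open>Q_linear_eqI\<close> and closure lemmas.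
\<close>

interpretation scale: Modules.module
  "scale :: 'k::comm_ring_1 xpoly \<Rightarrow> ('b \<Rightarrow>\<^sub>0 'k xpoly) \<Rightarrow> ('b \<Rightarrow>\<^sub>0 'k xpoly)"
  by standard (auto intro!: poly_mapping_eqI simp: lookup_add algebra_simps)

interpretation scale_pair: Modules.module_pair
  "scale :: 'k::comm_ring_1 xpoly \<Rightarrow> ('b \<Rightarrow>\<^sub>0 'k xpoly) \<Rightarrow> ('b \<Rightarrow>\<^sub>0 'k xpoly)"
  "scale :: 'k::comm_ring_1 xpoly \<Rightarrow> ('c \<Rightarrow>\<^sub>0 'k xpoly) \<Rightarrow> ('c \<Rightarrow>\<^sub>0 'k xpoly)"
  by standard

abbreviation Q_linear ::
  "(('b \<Rightarrow>\<^sub>0 'k::comm_ring_1 xpoly) \<Rightarrow> ('c \<Rightarrow>\<^sub>0 'k xpoly)) \<Rightarrow> bool" where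
  "Q_linear \<equiv> Modules.module_hom scale scale"

lemma Q_linearI:
  assumes "\<And>f g. F (f + g) = F f + F g" "\<And>q f. F (q *\<^sub>Q f) = q *\<^sub>Q F f"
  shows "Q_linear F"
  by (intro Modules.module_hom.intro Modules.module_hom_axioms.intro assms scale.module_axioms)

lemmas Q_linear_add = Modules.module_hom.add
  and Q_linear_scale = Modules.module_hom.scale
  and Q_linear_sum = Modules.module_hom.sum

lemma Q_linear_comp:
  "Q_linear F \<Longrightarrow> Q_linear G \<Longrightarrow> Q_linear (\<lambda>x. G (F x))"
  using Modules.module_hom_compose[of scale scale F scale G] by (simp add: o_def)

lemma sum_basis_elt:
  "f = (\<Sum>b\<in>Poly_Mapping.keys f. Poly_Mapping.lookup f b *\<^sub>Q basis_elt b)"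
  by (intro poly_mapping_eqI)
    (simp add: lookup_sum lookup_basis_elt sum.delta in_keys_iff if_distrib cong: if_cong)

lemma Q_linear_eqI:
  assumes "Q_linear F" "Q_linear G" "f \<in> free_carrier n B"
    and "\<And>b. b \<in> B \<Longrightarrow> F (basis_elt b) = G (basis_elt b)"
  shows "F f = G f"
proof -
  have "F f = (\<Sum>b\<in>Poly_Mapping.keys f. Poly_Mapping.lookup f b *\<^sub>Q F (basis_elt b))"
    by (subst sum_basis_elt) (simp only: Q_linear_sum[OF assms(1)] Q_linear_scale[OF assms(1)])
  also have "\<dots> = (\<Sum>b\<in>Poly_Mapping.keys f. Poly_Mapping.lookup f b *\<^sub>Q G (basis_elt b))"
    using assms(3,4) by (intro sum.cong refl) (auto simp: free_carrier_def)
  also have "\<dots> = G f"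
    by (subst (3) sum_basis_elt) (simp only: Q_linear_sum[OF assms(2)] Q_linear_scale[OF assms(2)])
  finally show ?thesis .
qed

lemma lin_ext_superset:
  assumes "finite S" "Poly_Mapping.keys f \<subseteq> S"
  shows "lin_ext h f = (\<Sum>b\<in>S. Poly_Mapping.lookup f b *\<^sub>Q h b)"
  unfolding lin_ext_def using assms by (intro sum.mono_neutral_left) (auto simp: in_keys_iff)

lemma Q_linear_lin_ext: "Q_linear (lin_ext h)"
proof (rule Q_linearI)
  show "lin_ext h (f + g) = lin_ext h f + lin_ext h g" for f g
    unfolding lin_ext_def by (rule setsum_keys_plus_distrib) (simp_all add: scale.scale_left_distrib)
  show "lin_ext h (q *\<^sub>Q f) = q *\<^sub>Q lin_ext h f" for q f
  proof -
    have "Poly_Mapping.keys (q *\<^sub>Q f) \<subseteq> Poly_Mapping.keys f"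
      by (auto simp: in_keys_iff)
    then show ?thesis
      by (simp add: lin_ext_superset[of "Poly_Mapping.keys f"] scale.scale_sum_right)
  qed
qed

lemma lin_ext_basis_elt [simp]: "lin_ext h (basis_elt b) = h b"
  by (simp add: lin_ext_def basis_elt_def)

lemma lin_ext_basis: "lin_ext basis_elt f = f"
  unfolding lin_ext_def by (rule sum_basis_elt[symmetric])

lemmas lin_ext_add = Q_linear_add[OF Q_linear_lin_ext]
  and lin_ext_scale = Q_linear_scale[OF Q_linear_lin_ext]
  and lin_ext_sum = Q_linear_sum[OF Q_linear_lin_ext]
  and lin_ext_diff = Modules.module_hom.diff[OF Q_linear_lin_ext]
  and lin_ext_uminus = Modules.module_hom.neg[OF Q_linear_lin_ext]
  and lin_ext_zero = Modules.module_hom.zero[OF Q_linear_lin_ext]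

lemmas lin_ext_simps = lin_ext_add lin_ext_scale lin_ext_sum lin_ext_diff lin_ext_uminus lin_ext_zero

lemma free_carrier_0 [simp]: "0 \<in> free_carrier n B"
  by (simp add: free_carrier_def)

lemma free_carrier_add [simp]:
  "f \<in> free_carrier n B \<Longrightarrow> g \<in> free_carrier n B \<Longrightarrow> f + g \<in> free_carrier n B"
  using Poly_Mapping.keys_add[of f g] by (auto simp: free_carrier_def lookup_add)

lemma free_carrier_uminus [simp]: "f \<in> free_carrier n B \<Longrightarrow> - f \<in> free_carrier n B"
  by (simp add: free_carrier_def)

lemma free_carrier_diff [simp]:
  "f \<in> free_carrier n B \<Longrightarrow> g \<in> free_carrier n B \<Longrightarrow> f - g \<in> free_carrier n B"
  using free_carrier_add[of f n B "- g"] by simp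

lemma free_carrier_scale [simp]:
  "q \<in> Q_carrier n \<Longrightarrow> f \<in> free_carrier n B \<Longrightarrow> q *\<^sub>Q f \<in> free_carrier n B"
  by (auto simp: free_carrier_def in_keys_iff subset_iff) (metis mult_zero_right)

lemma free_carrier_sum:
  "(\<And>x. x \<in> A \<Longrightarrow> f x \<in> free_carrier n B) \<Longrightarrow> (\<Sum>x\<in>A. f x) \<in> free_carrier n B"
  by (induction A rule: infinite_finite_induct) simp_all

lemma free_carrier_basis_elt [simp]: "b \<in> B \<Longrightarrow> basis_elt b \<in> free_carrier n B"
  by (auto simp: free_carrier_def lookup_basis_elt in_keys_iff split: if_splits)

lemma free_carrier_mono: "f \<in> free_carrier n B \<Longrightarrow> B \<subseteq> C \<Longrightarrow> f \<in> free_carrier n C"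
  by (auto simp: free_carrier_def)

lemma free_carrier_lin_ext:
  assumes "f \<in> free_carrier n B" "\<And>b. b \<in> B \<Longrightarrow> h b \<in> free_carrier n C"
  shows "lin_ext h f \<in> free_carrier n C"
  unfolding lin_ext_def
  using assms(1) by (intro free_carrier_sum free_carrier_scale assms(2)) (auto simp: free_carrier_def)

lemma free_gr_basis_elt [simp]: "b \<in> B \<Longrightarrow> deg b = i \<Longrightarrow> basis_elt b \<in> free_gr n B deg i"
  by (simp add: free_gr_def)

lemma free_gr_subset: "f \<in> free_gr n B deg i \<Longrightarrow> f \<in> free_carrier n B"
  unfolding free_gr_def by (erule free_carrier_mono) auto

lemma free_gr_0 [simp]: "0 \<in> free_gr n B deg i"
  and free_gr_add [simp]:
    "f \<in> free_gr n B deg i \<Longrightarrow> g \<in> free_gr n B deg i \<Longrightarrow> f + g \<in> free_gr n B deg i"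
  and free_gr_uminus [simp]: "f \<in> free_gr n B deg i \<Longrightarrow> - f \<in> free_gr n B deg i"
  and free_gr_diff [simp]:
    "f \<in> free_gr n B deg i \<Longrightarrow> g \<in> free_gr n B deg i \<Longrightarrow> f - g \<in> free_gr n B deg i"
  and free_gr_scale [simp]:
    "q \<in> Q_carrier n \<Longrightarrow> f \<in> free_gr n B deg i \<Longrightarrow> q *\<^sub>Q f \<in> free_gr n B deg i"
  by (simp_all add: free_gr_def)

lemma free_gr_sum:
  "(\<And>x. x \<in> A \<Longrightarrow> f x \<in> free_gr n B deg i) \<Longrightarrow> (\<Sum>x\<in>A. f x) \<in> free_gr n B deg i"
  by (simp add: free_gr_def free_carrier_sum)

lemma free_gr_lin_ext:
  assumes "f \<in> free_gr n B deg i"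
    and "\<And>b. b \<in> B \<Longrightarrow> deg b = i \<Longrightarrow> h b \<in> free_gr n C deg' j"
  shows "lin_ext h f \<in> free_gr n C deg' j"
  using assms unfolding free_gr_def by (intro free_carrier_lin_ext) auto

lemma lookup_free_gr:
  assumes "f \<in> free_gr n B deg i" "deg b \<noteq> i"
  shows "Poly_Mapping.lookup f b = 0"
  using assms by (auto simp: free_gr_def free_carrier_def simp flip: not_in_keys_iff_lookup_eq_zero)

section \<open>Dg structures given on bases\<close>

text \<open>
  Only the module operations of the record are prescribed, so that the same results serve an algebra,
  whose multiplication is meaningful, and a module, whose multiplication is not.
\<close>

locale free_module_record =
  fixes n :: nat and B :: "'b set"
    and M :: "('k::comm_ring_1 xpoly, 'b \<Rightarrow>\<^sub>0 'k xpoly, 'w) module_scheme"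
  assumes carrier_eq: "carrier M = free_carrier n B"
    and zero_eq: "\<zero>\<^bsub>M\<^esub> = 0"
    and add_eq: "add M = (+)"
    and smult_eq: "module.smult M = (*\<^sub>Q)"
begin

lemmas ops_eq = carrier_eq zero_eq add_eq smult_eq

lemma abelian_group: "abelian_group M"
proof (rule abelian_groupI)
  fix x assume "x \<in> carrier M"
  then show "\<exists>y\<in>carrier M. y \<oplus>\<^bsub>M\<^esub> x = \<zero>\<^bsub>M\<^esub>"
    by (intro bexI[of _ "- x"]) (simp_all add: ops_eq)
qed (simp_all add: ops_eq algebra_simps)

lemma module: "Module.module (Q_ring n) M"
  by (rule moduleI)
    (simp_all add: cring_Q_ring abelian_group ops_eq scale.scale_left_distrib scale.scale_right_distrib)

lemma finsum_eq: "finite A \<Longrightarrow> (\<And>i. i \<in> A \<Longrightarrow> f i \<in> carrier M) \<Longrightarrow> finsum M f A = (\<Sum>i\<in>A. f i)"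
proof (induction A rule: finite_induct)
  case empty
  interpret abelian_group M by (rule abelian_group)
  show ?case by (simp add: zero_eq)
next
  case (insert i A)
  interpret abelian_group M by (rule abelian_group)
  have "finsum M f (insert i A) = f i \<oplus>\<^bsub>M\<^esub> finsum M f A"
    using insert by (intro finsum_insert) auto
  then show ?case using insert by (simp add: add_eq)
qed

lemma gr_submodule: "submodule (free_gr n B deg i) (Q_ring n) M"
proof -
  interpret M: Module.module "Q_ring n" M by (rule module)
  have inv: "\<ominus>\<^bsub>M\<^esub> x = - x" if "x \<in> carrier M" for x
    using that by (intro M.minus_equality) (simp_all add: ops_eq)
  show ?thesis
    by (rule M.submoduleI) (auto simp: inv ops_eq free_gr_subset)
qed

text \<open>
  Distinct components have disjoint supports. Hence the component in degree \<open>i\<close> can only be the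
  restriction of \<open>x\<close> to the labels of degree \<open>i\<close>.
\<close>

lemma gr_decomposition:
  assumes x: "x \<in> carrier M"
  shows "\<exists>!f. (\<forall>i. f i \<in> free_gr n B deg i) \<and> finite {i. f i \<noteq> \<zero>\<^bsub>M\<^esub>} \<and>
    x = finsum M f {i. f i \<noteq> \<zero>\<^bsub>M\<^esub>}"
proof -
  define part where "part i = lin_ext (\<lambda>b. if deg b = i then basis_elt b else 0) x" for i
  have lookup_part: "Poly_Mapping.lookup (part i) b = (if deg b = i then Poly_Mapping.lookup x b else 0)"
    for i b
  proof -
    have "Poly_Mapping.lookup (part i) b = (\<Sum>c\<in>Poly_Mapping.keys x.
        if c = b then (if deg b = i then Poly_Mapping.lookup x b else 0) else 0)"
      unfolding part_def lin_ext_def lookup_sum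
      by (intro sum.cong) (auto simp: lookup_basis_elt)
    then show ?thesis by (simp add: sum.delta in_keys_iff)
  qed
  have lookup_finsum: "Poly_Mapping.lookup (finsum M f {i. f i \<noteq> \<zero>\<^bsub>M\<^esub>}) b =
      Poly_Mapping.lookup (f (deg b)) b"
    if f: "\<And>i. f i \<in> free_gr n B deg i" "finite {i. f i \<noteq> \<zero>\<^bsub>M\<^esub>}" for f b
  proof -
    have "Poly_Mapping.lookup (finsum M f {i. f i \<noteq> \<zero>\<^bsub>M\<^esub>}) b =
        (\<Sum>i | f i \<noteq> 0. Poly_Mapping.lookup (f i) b)"
      using f free_gr_subset[OF f(1)] by (subst finsum_eq) (auto simp: ops_eq lookup_sum)
    also have "\<dots> = (\<Sum>i | f i \<noteq> 0. if i = deg b then Poly_Mapping.lookup (f i) b else 0)"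
      using lookup_free_gr[OF f(1)] by (intro sum.cong) auto
    also have "\<dots> = Poly_Mapping.lookup (f (deg b)) b"
      using f(2) by (simp add: sum.delta zero_eq)
    finally show ?thesis .
  qed
  show ?thesis
  proof (intro ex1I[of _ part] conjI allI)
    fix i show gr: "part i \<in> free_gr n B deg i" for i
      unfolding part_def free_gr_def
      using x by (intro free_carrier_lin_ext[of _ _ B]) (auto simp: carrier_eq)
    have "part i = 0" if "i \<notin> deg ` Poly_Mapping.keys x" for i
      using that by - (rule poly_mapping_eqI, auto simp: lookup_part in_keys_iff)
    then have "{i. part i \<noteq> \<zero>\<^bsub>M\<^esub>} \<subseteq> deg ` Poly_Mapping.keys x"
      by (auto simp: zero_eq)
    then show fin: "finite {i. part i \<noteq> \<zero>\<^bsub>M\<^esub>}" by (rule finite_subset) simp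
    show "x = finsum M part {i. part i \<noteq> \<zero>\<^bsub>M\<^esub>}"
      by (intro poly_mapping_eqI) (simp add: lookup_finsum[OF gr fin] lookup_part)
  next
    fix f
    assume f: "(\<forall>i. f i \<in> free_gr n B deg i) \<and> finite {i. f i \<noteq> \<zero>\<^bsub>M\<^esub>} \<and>
      x = finsum M f {i. f i \<noteq> \<zero>\<^bsub>M\<^esub>}"
    have "Poly_Mapping.lookup (f i) b = Poly_Mapping.lookup (part i) b" for i b
    proof (cases "deg b = i")
      case True
      then show ?thesis using lookup_finsum[of f b] f by (simp add: lookup_part)
    next
      case False
      then show ?thesis using lookup_free_gr[of "f i" n B deg i b] f by (simp add: lookup_part)
    qed
    then show "f = part" by (intro ext) (rule poly_mapping_eqI)
  qed
qed

end

locale graded_differential =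
  fixes n :: nat and B :: "'b set" and deg :: "'b \<Rightarrow> nat"
    and h :: "'b \<Rightarrow> ('b \<Rightarrow>\<^sub>0 'k::comm_ring_1 xpoly)"
  assumes diff_degree: "b \<in> B \<Longrightarrow> deg b = Suc i \<Longrightarrow> h b \<in> free_gr n B deg i"
    and diff_degree_0: "b \<in> B \<Longrightarrow> deg b = 0 \<Longrightarrow> h b = 0"
    and diff_diff: "b \<in> B \<Longrightarrow> lin_ext h (h b) = 0"
begin

lemma diff_closed: "b \<in> B \<Longrightarrow> h b \<in> free_carrier n B"
  using diff_degree diff_degree_0 free_gr_subset by (cases "deg b") fastforce+

end

locale free_complex = free_module_record n B M + graded_differential n B deg h
  for n :: nat and B :: "'b set"
    and M :: "('k::comm_ring_1 xpoly, 'b \<Rightarrow>\<^sub>0 'k xpoly, 'w) module_scheme"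
    and deg :: "'b \<Rightarrow> nat" and h :: "'b \<Rightarrow> ('b \<Rightarrow>\<^sub>0 'k xpoly)"
begin

lemma dg_complex: "dg_complex (Q_ring n) M (free_gr n B deg) (lin_ext h)"
proof (intro dg_complex.intro dg_complex_axioms.intro module gr_submodule gr_decomposition)
  show "lin_ext h x = \<zero>\<^bsub>M\<^esub>" if "x \<in> free_gr n B deg 0" for x
    unfolding zero_eq
    by (rule Q_linear_eqI[OF Q_linear_lin_ext scale_pair.module_hom_zero that[unfolded free_gr_def]])
      (simp add: diff_degree_0)
  show "lin_ext h (lin_ext h x) = \<zero>\<^bsub>M\<^esub>" if "x \<in> carrier M" for x
    unfolding zero_eq
    by (rule Q_linear_eqI[OF Q_linear_comp[OF Q_linear_lin_ext Q_linear_lin_ext]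
        scale_pair.module_hom_zero that[unfolded carrier_eq]]) (simp add: diff_diff)
qed (auto simp: ops_eq lin_ext_simps intro: free_carrier_lin_ext diff_closed free_gr_lin_ext diff_degree)

end

definition bilin_ext :: "('a \<Rightarrow> 'b \<Rightarrow> ('c \<Rightarrow>\<^sub>0 'k::comm_ring_1 xpoly)) \<Rightarrow>
    ('a \<Rightarrow>\<^sub>0 'k xpoly) \<Rightarrow> ('b \<Rightarrow>\<^sub>0 'k xpoly) \<Rightarrow> ('c \<Rightarrow>\<^sub>0 'k xpoly)" where
  "bilin_ext m f g = lin_ext (\<lambda>x. lin_ext (m x) g) f"

lemma bilin_ext_basis_elt [simp]: "bilin_ext m (basis_elt x) g = lin_ext (m x) g"
  by (simp add: bilin_ext_def)

lemma Q_linear_bilin_ext_left: "Q_linear (\<lambda>f. bilin_ext m f g)"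
  unfolding bilin_ext_def by (rule Q_linear_lin_ext)

lemma Q_linear_bilin_ext_right: "Q_linear (bilin_ext m f)"
  by (rule Q_linearI)
    (simp_all add: bilin_ext_def lin_ext_simps lin_ext_def[of _ f] scale.scale_right_distrib
      sum.distrib scale.scale_sum_right scale.scale_left_commute del: scale.scale_scale)

text \<open>
  The dg module axioms for basis elements only. Every axiom compares two maps that are linear in
  each argument, so \<open>Q_linear_eqI\<close>, applied to one argument after another, extends it to all
  elements. The second basis may be the first one with the same differential: an algebra acting
  on itself is how \<open>free_dg_algebra\<close> gets associativity and the Leibniz rule.
\<close>

locale dg_action =
  A: graded_differential n A degA hA + graded_differential n B deg h
  for n :: nat and A :: "'a set" and degA :: "'a \<Rightarrow> nat"
    and hA :: "'a \<Rightarrow> ('a \<Rightarrow>\<^sub>0 'k::comm_ring_1 xpoly)"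
    and B :: "'b set" and deg :: "'b \<Rightarrow> nat" and h :: "'b \<Rightarrow> ('b \<Rightarrow>\<^sub>0 'k xpoly)" +
  fixes unit :: 'a and mA :: "'a \<Rightarrow> 'a \<Rightarrow> ('a \<Rightarrow>\<^sub>0 'k xpoly)"
    and m :: "'a \<Rightarrow> 'b \<Rightarrow> ('b \<Rightarrow>\<^sub>0 'k xpoly)"
  assumes action_degree: "x \<in> A \<Longrightarrow> u \<in> B \<Longrightarrow> m x u \<in> free_gr n B deg (degA x + deg u)"
    and action_unit: "u \<in> B \<Longrightarrow> m unit u = basis_elt u"
    and action_assoc: "x \<in> A \<Longrightarrow> y \<in> A \<Longrightarrow> u \<in> B \<Longrightarrow>
      bilin_ext m (mA x y) (basis_elt u) = lin_ext (m x) (m y u)"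
    and action_leibniz: "x \<in> A \<Longrightarrow> u \<in> B \<Longrightarrow>
      lin_ext h (m x u) = bilin_ext m (hA x) (basis_elt u) + (-1) ^ degA x *\<^sub>Q lin_ext (m x) (h u)"
begin

lemma bilin_ext_degree:
  assumes "x \<in> free_gr n A degA i" "u \<in> free_gr n B deg j"
  shows "bilin_ext m x u \<in> free_gr n B deg (i + j)"
  unfolding bilin_ext_def
  by (intro free_gr_lin_ext[OF assms(1)] free_gr_lin_ext[OF assms(2)]) (auto intro: action_degree)

lemma bilin_ext_closed:
  assumes "x \<in> free_carrier n A" "u \<in> free_carrier n B"
  shows "bilin_ext m x u \<in> free_carrier n B"
  unfolding bilin_ext_def
  by (intro free_carrier_lin_ext[OF assms(1)] free_carrier_lin_ext[OF assms(2)])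
    (auto intro: action_degree free_gr_subset)

lemma bilin_ext_unit:
  assumes "u \<in> free_carrier n B"
  shows "bilin_ext m (basis_elt unit) u = u"
  by (rule Q_linear_eqI[OF Q_linear_bilin_ext_right scale.module_hom_ident assms])
    (simp add: action_unit)

lemma bilin_ext_assoc:
  assumes x: "x \<in> free_carrier n A" and y: "y \<in> free_carrier n A" and u: "u \<in> free_carrier n B"
  shows "bilin_ext m (bilin_ext mA x y) u = bilin_ext m x (bilin_ext m y u)"
proof (rule Q_linear_eqI[OF _ _ x])
  fix a assume a: "a \<in> A"
  show "bilin_ext m (bilin_ext mA (basis_elt a) y) u = bilin_ext m (basis_elt a) (bilin_ext m y u)"
  proof (rule Q_linear_eqI[OF _ _ y])
    fix b assume b: "b \<in> A"
    show "bilin_ext m (bilin_ext mA (basis_elt a) (basis_elt b)) u =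
        bilin_ext m (basis_elt a) (bilin_ext m (basis_elt b) u)"
    proof (rule Q_linear_eqI[OF _ _ u])
      fix c assume c: "c \<in> B"
      show "bilin_ext m (bilin_ext mA (basis_elt a) (basis_elt b)) (basis_elt c) =
          bilin_ext m (basis_elt a) (bilin_ext m (basis_elt b) (basis_elt c))"
        using action_assoc[OF a b c] by simp
    qed (intro Q_linear_bilin_ext_right Q_linear_comp[OF Q_linear_bilin_ext_right])+
  qed (intro Q_linear_comp[OF Q_linear_bilin_ext_right Q_linear_bilin_ext_left]
      Q_linear_comp[OF Q_linear_bilin_ext_left Q_linear_bilin_ext_right])+
qed (intro Q_linear_comp[OF Q_linear_bilin_ext_left Q_linear_bilin_ext_left] Q_linear_bilin_ext_left)+

lemma bilin_ext_leibniz: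
  assumes x: "x \<in> free_gr n A degA i" and u: "u \<in> free_gr n B deg j"
  shows "lin_ext h (bilin_ext m x u) =
    bilin_ext m (lin_ext hA x) u + (-1) ^ i *\<^sub>Q bilin_ext m x (lin_ext h u)"
proof (rule Q_linear_eqI[OF _ _ x[unfolded free_gr_def]])
  fix a assume a: "a \<in> {b \<in> A. degA b = i}"
  show "lin_ext h (bilin_ext m (basis_elt a) u) =
    bilin_ext m (lin_ext hA (basis_elt a)) u + (-1) ^ i *\<^sub>Q bilin_ext m (basis_elt a) (lin_ext h u)"
  proof (rule Q_linear_eqI[OF _ _ u[unfolded free_gr_def]])
    fix c assume "c \<in> {b \<in> B. deg b = j}"
    then show "lin_ext h (bilin_ext m (basis_elt a) (basis_elt c)) =
      bilin_ext m (lin_ext hA (basis_elt a)) (basis_elt c) +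
      (-1) ^ i *\<^sub>Q bilin_ext m (basis_elt a) (lin_ext h (basis_elt c))"
      using action_leibniz[of a c] a by simp
  qed (intro Q_linear_comp[OF Q_linear_bilin_ext_right Q_linear_lin_ext]
      Q_linear_comp[OF Q_linear_lin_ext Q_linear_bilin_ext_right] Q_linear_bilin_ext_right
      scale_pair.module_hom_add scale_pair.module_hom_scale)+
qed (intro Q_linear_comp[OF Q_linear_bilin_ext_left Q_linear_lin_ext]
      Q_linear_comp[OF Q_linear_lin_ext Q_linear_bilin_ext_left] Q_linear_bilin_ext_left
      scale_pair.module_hom_add scale_pair.module_hom_scale)+

end

lemma free_dg_algebra:
  fixes M :: "('k::comm_ring_1 xpoly, 'a \<Rightarrow>\<^sub>0 'k xpoly, 'w) module_scheme"
  assumes act: "dg_action n A degA hA A degA hA unit mA mA"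
    and M: "free_module_record n A M"
    and unit: "unit \<in> A" "degA unit = 0" "\<And>x. x \<in> A \<Longrightarrow> mA x unit = basis_elt x"
    and one_eq: "\<one>\<^bsub>M\<^esub> = basis_elt unit" and mult_eq: "mult M = bilin_ext mA"
  shows "dg_algebra (Q_ring n) M (free_gr n A degA) (lin_ext hA)"
proof -
  interpret dg_action n A degA hA A degA hA unit mA mA by (rule act)
  interpret free_module_record n A M by (rule M)
  interpret free_complex n A M degA hA ..
  have right_unit: "bilin_ext mA x (basis_elt unit) = x" if "x \<in> free_carrier n A" for x
    by (rule Q_linear_eqI[OF Q_linear_bilin_ext_left scale.module_hom_ident that])
      (simp add: unit(3))
  have "ring M"
    using Q_linear_add[OF Q_linear_bilin_ext_left[of mA]] Q_linear_add[OF Q_linear_bilin_ext_right[of mA]]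
    by (intro ringI abelian_group monoidI)
      (simp_all add: ops_eq one_eq mult_eq unit(1) bilin_ext_closed bilin_ext_assoc bilin_ext_unit[simplified] right_unit)
  moreover have "dg_algebra_axioms (Q_ring n) M (free_gr n A degA) (lin_ext hA)"
    using Q_linear_scale[OF Q_linear_bilin_ext_left[of mA]]
      Q_linear_scale[OF Q_linear_bilin_ext_right[of mA]]
    by (intro dg_algebra_axioms.intro)
      (simp_all add: ops_eq one_eq mult_eq unit(1,2) bilin_ext_degree bilin_ext_leibniz
        Q_ring_power_minus_1[simplified])
  ultimately show ?thesis by (intro dg_algebra.intro dg_complex)
qed

lemma free_dg_module:
  fixes M :: "('k::comm_ring_1 xpoly, 'a \<Rightarrow>\<^sub>0 'k xpoly, 'v) module_scheme"
    and N :: "('k xpoly, 'b \<Rightarrow>\<^sub>0 'k xpoly, 'w) module_scheme"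
  assumes alg: "dg_algebra (Q_ring n) M (free_gr n A degA) (lin_ext hA)"
    and M: "free_module_record n A M"
    and one_eq: "\<one>\<^bsub>M\<^esub> = basis_elt unit" and mult_eq: "mult M = bilin_ext mA"
    and act: "dg_action n A degA hA B deg h unit mA m"
    and N: "free_module_record n B N"
  shows "dg_module (Q_ring n) M (free_gr n A degA) (lin_ext hA) N (free_gr n B deg) (lin_ext h)
    (bilin_ext m)"
proof -
  interpret dg_action n A degA hA B deg h unit mA m by (rule act)
  interpret M: free_module_record n A M by (rule M)
  interpret free_module_record n B N by (rule N)
  interpret free_complex n B N deg h ..
  have "dg_module_axioms (Q_ring n) M (free_gr n A degA) (lin_ext hA) N (free_gr n B deg) (lin_ext h)
    (bilin_ext m)"
    using Q_linear_add[OF Q_linear_bilin_ext_left[of m]] Q_linear_add[OF Q_linear_bilin_ext_right[of m]]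
      Q_linear_scale[OF Q_linear_bilin_ext_left[of m]] Q_linear_scale[OF Q_linear_bilin_ext_right[of m]]
    by (intro dg_module_axioms.intro)
      (simp_all add: ops_eq M.ops_eq one_eq mult_eq bilin_ext_closed bilin_ext_assoc bilin_ext_unit[simplified]
        bilin_ext_degree bilin_ext_leibniz Q_ring_power_minus_1[simplified])
  then show ?thesis by (intro dg_module.intro alg dg_complex)
qed

section \<open>The Hilbert-Burch dg algebra\<close>

text \<open>
  After this interchange the coefficient of each basis element is a sum of products of a variable
  and a minor, to which one of the expansions applies.
\<close>

lemma sum_scale_swap:
  "(\<Sum>k\<in>K. p k *\<^sub>Q (\<Sum>l\<in>L. q k l *\<^sub>Q v l)) = (\<Sum>l\<in>L. (\<Sum>k\<in>K. p k * q k l) *\<^sub>Q v l)"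
  unfolding scale.scale_sum_right scale.scale_sum_left scale.scale_scale by (rule sum.swap)

lemma scale_if: "(if P then p else 0) *\<^sub>Q v = (if P then p *\<^sub>Q v else 0)"
  by simp

lemma scale_if_right: "p *\<^sub>Q (if P then v else 0) = (if P then p *\<^sub>Q v else 0)"
  by simp

lemma minus_1_power_Suc_mult: "(-1) ^ (l + 1) * p * (-1) ^ l = (- p :: 'a::comm_ring_1)"
  by (simp add: mult.assoc mult.left_commute flip: power_add)

lemma A_basis_cases [consumes 1, case_names one e T]:
  assumes "x \<in> A_basis n"
  obtains "x = One_lab" | i where "x = E_lab i" "i \<in> {1..n+1}" | i where "x = T_lab i" "i \<in> {1..n}"
  using assms unfolding A_basis_def by blast

lemma in_A_basis [simp]:
  "One_lab \<in> A_basis n" "i \<in> {1..n+1} \<Longrightarrow> E_lab i \<in> A_basis n" "i \<in> {1..n} \<Longrightarrow> T_lab i \<in> A_basis n"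
  by (auto simp: A_basis_def)

text \<open>
  With coefficients \<open>minor_deriv\<close> the product needs no case distinction: antisymmetry accounts for
  \<open>j < i\<close> and its consequence on the diagonal for \<open>i = j\<close>.
\<close>

lemma e_e_eq:
  assumes "i \<in> {1..n+1}" "j \<in> {1..n+1}"
  shows "A_mult_basis n (E_lab i) (E_lab j) =
    (\<Sum>k = 1..n. minor_deriv n i k j *\<^sub>Q (TA k :: 'k::comm_ring_1 A_type))"
proof (cases i j rule: linorder_cases)
  case less
  then show ?thesis
    by (auto simp: ee_def minor_deriv_less[OF _ assms less] intro!: sum.cong)
next
  case equal
  then show ?thesis
    using assms by (auto simp: minor_deriv_same intro!: sum.neutral[symmetric])
next
  case greater
  have "- ee n j i = (\<Sum>k = 1..n. (- minor_deriv n j k i) *\<^sub>Q (TA k :: 'k A_type))"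
    unfolding ee_def sum_negf[symmetric]
    by (intro sum.cong refl) (simp add: minor_deriv_less[OF _ assms(2,1) greater])
  also have "\<dots> = (\<Sum>k = 1..n. minor_deriv n i k j *\<^sub>Q (TA k :: 'k A_type))"
    by (intro sum.cong refl) (simp only: minor_deriv_antisym[OF _ assms])
  finally show ?thesis using greater by simp
qed

lemma A_diff_basis_e: "A_diff_basis n (E_lab i) = signed_minor n i *\<^sub>Q A_one"
  by (simp add: signed_minor_def)

text \<open>
  From here on products and differentials are computed through the signed minors and their
  derivatives.
\<close>

declare A_diff_basis.simps(2) [simp del] A_mult_basis.simps(4) [simp del]

lemma A_mult_basis_degree:
  assumes "x \<in> A_basis n" "y \<in> A_basis n"
  shows "(A_mult_basis n x y :: 'k::comm_ring_1 A_type) \<in>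
    free_gr n (A_basis n) A_deg (A_deg x + A_deg y)"
  using assms(1)
proof (cases rule: A_basis_cases)
  case (e i)
  show ?thesis using assms(2)
  proof (cases rule: A_basis_cases)
    case (e j)
    then show ?thesis
      using \<open>x = E_lab i\<close> \<open>i \<in> _\<close> by (auto simp: e_e_eq intro!: free_gr_sum)
  qed (use e in auto)
next
  case (T i)
  then show ?thesis using assms(2) by (cases y) auto
qed (use assms in simp)

lemma A_graded_differential:
  "graded_differential n (A_basis n) A_deg (A_diff_basis n :: _ \<Rightarrow> 'k::comm_ring_1 A_type)"
proof
  fix x i assume "x \<in> A_basis n" "A_deg x = Suc i"
  then show "(A_diff_basis n x :: 'k A_type) \<in> free_gr n (A_basis n) A_deg i"
    by (cases rule: A_basis_cases) (auto simp: A_diff_basis_e intro!: free_gr_sum)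
next
  fix x assume "A_deg x = 0"
  then show "A_diff_basis n x = (0 :: 'k A_type)" by (cases x) auto
next
  fix x assume "x \<in> A_basis n"
  then show "lin_ext (A_diff_basis n) (A_diff_basis n x) = (0 :: 'k A_type)"
  proof (cases rule: A_basis_cases)
    case (T i)
    have "lin_ext (A_diff_basis n) (A_diff_basis n x) =
        (\<Sum>l = 1..n+1. xvar i l * signed_minor n l) *\<^sub>Q (A_one :: 'k A_type)"
      unfolding scale.scale_sum_left by (simp add: T(1) lin_ext_simps A_diff_basis_e)
    then show ?thesis by (simp only: sum_xvar_signed_minor[OF T(2)] scale.scale_zero_left)
  qed (simp_all add: A_diff_basis_e lin_ext_simps)
qed

text \<open>
  This is \<open>e\<^sub>i \<cdot> \<partial>(T\<^sub>j)\<close>, so it is the Leibniz rule for the vanishing product \<open>e\<^sub>i T\<^sub>j\<close>.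
\<close>

lemma sum_xvar_e_e:
  assumes "i \<in> {1..n+1}" "j \<in> {1..n}"
  shows "(\<Sum>l = 1..n+1. xvar j l *\<^sub>Q A_mult_basis n (E_lab i) (E_lab l)) =
    signed_minor n i *\<^sub>Q (TA j :: 'k::comm_ring_1 A_type)"
proof -
  have "(\<Sum>l = 1..n+1. xvar j l *\<^sub>Q A_mult_basis n (E_lab i) (E_lab l)) =
      (\<Sum>l = 1..n+1. xvar j l *\<^sub>Q (\<Sum>k = 1..n. minor_deriv n i k l *\<^sub>Q (TA k :: 'k A_type)))"
    by (intro sum.cong refl) (simp only: e_e_eq[OF assms(1)])
  also have "\<dots> = (\<Sum>k = 1..n. (if j = k then signed_minor n i else 0) *\<^sub>Q TA k)"
    unfolding sum_scale_swap
    by (intro sum.cong refl) (simp only: sum_xvar_minor_deriv[OF assms(2) _ assms(1)])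
  also have "\<dots> = signed_minor n i *\<^sub>Q TA j"
    using assms(2) by (simp add: scale_if sum.delta')
  finally show ?thesis .
qed

lemma e_e_antisym:
  assumes "i \<in> {1..n+1}" "j \<in> {1..n+1}"
  shows "A_mult_basis n (E_lab j) (E_lab i) = - (A_mult_basis n (E_lab i) (E_lab j) :: 'k::comm_ring_1 A_type)"
  using assms by (auto simp: A_mult_basis.simps(4))

lemma diff_e_e:
  assumes "i \<in> {1..n+1}" "j \<in> {1..n+1}"
  shows "lin_ext (A_diff_basis n) (A_mult_basis n (E_lab i) (E_lab j)) =
    signed_minor n i *\<^sub>Q eA j - signed_minor n j *\<^sub>Q (eA i :: 'k::comm_ring_1 A_type)"
proof -
  have "lin_ext (A_diff_basis n) (A_mult_basis n (E_lab i) (E_lab j)) =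
      (\<Sum>k = 1..n. minor_deriv n i k j *\<^sub>Q (\<Sum>l = 1..n+1. xvar k l *\<^sub>Q (eA l :: 'k A_type)))"
    unfolding e_e_eq[OF assms] by (simp add: lin_ext_simps)
  also have "\<dots> = (\<Sum>l = 1..n+1.
      ((if j = l then signed_minor n i else 0) - (if i = l then signed_minor n j else 0)) *\<^sub>Q eA l)"
    unfolding sum_scale_swap
    by (intro sum.cong refl) (simp only: sum_minor_deriv_xvar_rows[OF assms(2) _ assms(1)])
  also have "\<dots> = signed_minor n i *\<^sub>Q eA j - signed_minor n j *\<^sub>Q eA i"
    using assms by (simp add: scale.scale_left_diff_distrib sum_subtractf scale_if sum.delta')
  finally show ?thesis .
qed

text \<open>
  Associativity holds for degree reasons unless one of the factors is 1: a product of three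
  elements of positive degree would have degree at least 3.
\<close>

lemma A_dg_action:
  "dg_action n (A_basis n) A_deg (A_diff_basis n) (A_basis n) A_deg (A_diff_basis n)
    One_lab (A_mult_basis n) (A_mult_basis n :: _ \<Rightarrow> _ \<Rightarrow> 'k::comm_ring_1 A_type)"
proof (intro dg_action.intro A_graded_differential dg_action_axioms.intro A_mult_basis_degree)
  let ?m = "A_mult_basis n :: _ \<Rightarrow> _ \<Rightarrow> 'k A_type"
  let ?d = "A_diff_basis n :: _ \<Rightarrow> 'k A_type"
  fix x y assume x: "x \<in> A_basis n" and y: "y \<in> A_basis n"
  have one: "?m One_lab = basis_elt" by (intro ext) simp
  show "lin_ext ?d (?m x y) =
      bilin_ext ?m (?d x) (basis_elt y) + (-1) ^ A_deg x *\<^sub>Q lin_ext (?m x) (?d y)"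
    using x
  proof (cases rule: A_basis_cases)
    case one
    then show ?thesis by (simp add: \<open>?m One_lab = basis_elt\<close> lin_ext_basis bilin_ext_def lin_ext_simps)
  next
    case x: (e i)
    show ?thesis using y
    proof (cases rule: A_basis_cases)
      case one
      then show ?thesis using x by (simp add: bilin_ext_def lin_ext_simps A_diff_basis_e)
    next
      case y: (e j)
      show ?thesis
        unfolding x(1) y(1) diff_e_e[OF x(2) y(2)]
        by (simp add: bilin_ext_def lin_ext_simps A_diff_basis_e)
    next
      case y: (T j)
      have "lin_ext (?m x) (?d y) = signed_minor n i *\<^sub>Q TA j"
        using sum_xvar_e_e[OF x(2) y(2)] by (simp add: x(1) y(1) lin_ext_simps)
      then show ?thesis
        by (simp add: x(1) y(1) bilin_ext_def lin_ext_simps A_diff_basis_e)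
    qed
  next
    case x: (T i)
    show ?thesis using y
    proof (cases rule: A_basis_cases)
      case one
      then show ?thesis using x by (simp add: bilin_ext_def lin_ext_simps)
    next
      case y: (e j)
      have "bilin_ext ?m (?d x) (basis_elt y) =
          (\<Sum>l = 1..n+1. xvar i l *\<^sub>Q ?m (E_lab l) (E_lab j))"
        by (simp add: x(1) y(1) bilin_ext_def lin_ext_simps)
      also have "\<dots> = - (\<Sum>l = 1..n+1. xvar i l *\<^sub>Q ?m (E_lab j) (E_lab l))"
        unfolding sum_negf[symmetric]
        by (intro sum.cong refl) (simp only: e_e_antisym[OF y(2)] scale.scale_minus_right)
      also have "\<dots> = - (signed_minor n j *\<^sub>Q TA i)"
        unfolding sum_xvar_e_e[OF y(2) x(2)] ..
      finally show ?thesis by (simp add: x(1) y(1) lin_ext_simps A_diff_basis_e)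
    next
      case y: (T j)
      show ?thesis by (simp add: x(1) y(1) bilin_ext_def lin_ext_simps)
    qed
  qed
next
  let ?m = "A_mult_basis n :: _ \<Rightarrow> _ \<Rightarrow> 'k A_type"
  fix x y z assume x: "x \<in> A_basis n" and y: "y \<in> A_basis n" and z: "z \<in> A_basis n"
  have one: "?m One_lab = basis_elt" by (intro ext) simp
  show "bilin_ext ?m (?m x y) (basis_elt z) = lin_ext (?m x) (?m y z)"
    using x y z
    by (elim A_basis_cases)
      (simp_all add: one bilin_ext_def lin_ext_simps lin_ext_basis e_e_eq del: One_nat_def)
qed simp_all

lemma A_free_module_record:
  "free_module_record n (A_basis n) (A_alg n :: ('k::comm_ring_1 xpoly, 'k A_type) module)"
  by standard (simp_all add: A_alg_def)

lemma A_mult_eq: "A_mult n = bilin_ext (A_mult_basis n)"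
  by (intro ext) (simp add: A_mult_def bilin_ext_def)

lemma A_dg_algebra:
  "dg_algebra (Q_ring n) (A_alg n) (free_gr n (A_basis n) A_deg)
    (lin_ext (A_diff_basis n) :: 'k::comm_ring_1 A_type \<Rightarrow> _)"
proof (rule free_dg_algebra[OF A_dg_action A_free_module_record])
  show "A_mult_basis n x One_lab = basis_elt x" for x by (cases x) auto
qed (simp_all add: A_alg_def A_mult_eq)

section \<open>The action on the complex \<open>\<U>\<close>\<close>

lemma U_basis_cases [consumes 1, case_names a b c]:
  assumes "u \<in> U_basis n"
  obtains i where "u = a_lab i" "i \<in> {1..n+1}"
  | j k where "u = b_lab j k" "j \<in> {1..n}" "k \<in> {1..n+1}"
  | j k where "u = c_lab j k" "j \<in> {1..n}" "k \<in> {1..n}" "(j, k) \<noteq> (1, 1)"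
  using assms unfolding U_basis_def by blast

lemma in_U_basis [simp]:
  "i \<in> {1..n+1} \<Longrightarrow> a_lab i \<in> U_basis n"
  "j \<in> {1..n} \<Longrightarrow> k \<in> {1..n+1} \<Longrightarrow> b_lab j k \<in> U_basis n"
  "j \<in> {1..n} \<Longrightarrow> k \<in> {1..n} \<Longrightarrow> (j, k) \<noteq> (1, 1) \<Longrightarrow> c_lab j k \<in> U_basis n"
  by (auto simp: U_basis_def)

lemma cU_degree [simp]:
  assumes "j \<in> {1..n}" "k \<in> {1..n}"
  shows "cU j k \<in> free_gr n (U_basis n) U_deg 2"
proof (cases "(j, k) = (1, 1)")
  case False
  then have "c_lab j k \<in> U_basis n" using assms by (auto simp: U_basis_def)
  then show ?thesis using False by (auto simp: cU_def)
qed (simp add: cU_def)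

lemma cU_1_1 [simp]: "cU 1 1 = 0"
  by (simp add: cU_def)

text \<open>
  The differential sends \<open>\<Sum>\<^sub>k x\<^sub>1\<^sub>k b\<^sub>1\<^sub>k\<close> to the vector of the polynomials \<open>\<Sum>\<^sub>k x\<^sub>1\<^sub>k \<partial>F\<^sub>l/\<partial>x\<^sub>1\<^sub>k\<close>. As \<open>F\<^sub>l\<close> is
  linear in the first row, Euler's relation identifies this vector with \<open>\<Sum>\<^sub>l F\<^sub>l a\<^sub>l\<close>, which is
  \<open>euler_a n\<close>. Subtracting \<open>euler_b n\<close> in \<open>\<partial>(c\<^sub>i\<^sub>i)\<close> therefore leaves a cycle, and for \<open>i = 1\<close> it leaves zero, in
  accordance with \<open>c\<^sub>1\<^sub>1 = 0\<close>.
\<close>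

definition euler_b :: "nat \<Rightarrow> 'k::comm_ring_1 U_type" where
  "euler_b n = (\<Sum>k = 1..n+1. xvar 1 k *\<^sub>Q bU 1 k)"

definition euler_a :: "nat \<Rightarrow> 'k::comm_ring_1 U_type" where
  "euler_a n = (\<Sum>l = 1..n+1. ((-1) ^ (l + 1) * signed_minor n l) *\<^sub>Q aU l)"

lemma U_diff_basis_b:
  assumes "i \<in> {1..n}" "j \<in> {1..n+1}"
  shows "U_diff_basis n (b_lab i j) =
    (\<Sum>l = 1..n+1. ((-1) ^ (l + 1) * minor_deriv n l i j) *\<^sub>Q (aU l :: 'k::comm_ring_1 U_type))"
  by (simp only: U_diff_basis.simps, intro sum.cong refl) (simp only: pdiff_F_minor[OF _ assms])

lemma U_diff_basis_c:
  "U_diff_basis n (c_lab i j) =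
    (\<Sum>l = 1..n+1. xvar i l *\<^sub>Q bU j l) - (if i = j then euler_b n else 0)"
  by (simp add: euler_b_def)

declare U_diff_basis.simps(2,3) [simp del]

lemma diff_cU:
  "lin_ext (U_diff_basis n) (cU i j) =
    (\<Sum>l = 1..n+1. xvar i l *\<^sub>Q bU j l) - (if i = j then euler_b n else (0 :: 'k::comm_ring_1 U_type))"
proof (cases "(i, j) = (1, 1)")
  case True
  then have "i = 1" "j = 1" by auto
  then show ?thesis by (simp only: cU_1_1 lin_ext_zero) (simp add: euler_b_def)
next
  case False
  then have "cU i j = (basis_elt (c_lab i j) :: 'k U_type)" by (auto simp: cU_def)
  then show ?thesis by (simp only: lin_ext_basis_elt U_diff_basis_c)
qed

text \<open>
  Euler's relation for row \<open>i\<close> when \<open>i = j\<close>; otherwise row \<open>j\<close> of \<open>X\<close> is replaced by row \<open>i\<close>, and a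
  minor with two equal rows vanishes. In particular the value for \<open>i = j\<close> is the same for all rows,
  which is why \<open>\<partial>\<partial>(c\<^sub>i\<^sub>j) = 0\<close>.
\<close>

lemma diff_row_b:
  assumes "i \<in> {1..n}" "j \<in> {1..n}"
  shows "lin_ext (U_diff_basis n) (\<Sum>l = 1..n+1. xvar i l *\<^sub>Q bU j l) =
    (if i = j then euler_a n else (0 :: 'k::comm_ring_1 U_type))"
proof -
  have "lin_ext (U_diff_basis n) (\<Sum>l = 1..n+1. xvar i l *\<^sub>Q bU j l) =
      (\<Sum>l = 1..n+1. xvar i l *\<^sub>Q (\<Sum>m = 1..n+1.
        ((-1) ^ (m + 1) * minor_deriv n m j l) *\<^sub>Q (aU m :: 'k U_type)))"
    unfolding lin_ext_simps lin_ext_basis_elt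
    by (intro sum.cong refl) (simp only: U_diff_basis_b[OF assms(2)])
  also have "\<dots> = (\<Sum>m = 1..n+1.
      ((-1) ^ (m + 1) * (\<Sum>l = 1..n+1. xvar i l * minor_deriv n m j l)) *\<^sub>Q aU m)"
    unfolding sum_scale_swap by (simp only: mult.left_commute sum_distrib_left)
  also have "\<dots> = (\<Sum>m = 1..n+1.
      ((-1) ^ (m + 1) * (if i = j then signed_minor n m else 0)) *\<^sub>Q aU m)"
    by (intro sum.cong refl) (simp only: sum_xvar_minor_deriv[OF assms])
  also have "\<dots> = (if i = j then euler_a n else 0)"
    by (simp add: euler_a_def)
  finally show ?thesis .
qed

lemma diff_euler_b:
  "n \<ge> 1 \<Longrightarrow> lin_ext (U_diff_basis n) (euler_b n) = euler_a n"
  unfolding euler_b_def by (subst diff_row_b) auto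

lemma diff_column_b:
  assumes "i \<in> {1..n+1}" "j \<in> {1..n+1}"
  shows "lin_ext (U_diff_basis n) (\<Sum>k = 1..n. xvar k j *\<^sub>Q bU k i) =
    (if i = j then euler_a n else 0) + ((-1) ^ j * signed_minor n i) *\<^sub>Q (aU j :: 'k::comm_ring_1 U_type)"
proof -
  have "lin_ext (U_diff_basis n) (\<Sum>k = 1..n. xvar k j *\<^sub>Q bU k i) =
      (\<Sum>k = 1..n. xvar k j *\<^sub>Q (\<Sum>l = 1..n+1.
        ((-1) ^ (l + 1) * minor_deriv n l k i) *\<^sub>Q (aU l :: 'k U_type)))"
    unfolding lin_ext_simps lin_ext_basis_elt
    by (intro sum.cong refl) (simp only: U_diff_basis_b[OF _ assms(1)])
  also have "\<dots> = (\<Sum>l = 1..n+1.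
      ((-1) ^ (l + 1) * (\<Sum>k = 1..n. minor_deriv n l k i * xvar k j)) *\<^sub>Q aU l)"
    unfolding sum_scale_swap by (simp only: mult.commute mult.left_commute sum_distrib_left)
  also have "\<dots> = (\<Sum>l = 1..n+1. ((-1) ^ (l + 1) *
      ((if i = j then signed_minor n l else 0) - (if l = j then signed_minor n i else 0))) *\<^sub>Q aU l)"
    by (intro sum.cong refl) (simp only: sum_minor_deriv_xvar_rows[OF assms])
  also have "\<dots> = (\<Sum>l = 1..n+1.
      (if i = j then ((-1) ^ (l + 1) * signed_minor n l) *\<^sub>Q aU l else 0) +
      (if l = j then ((-1) ^ l * signed_minor n i) *\<^sub>Q aU l else 0))"
    by (intro sum.cong refl) (simp add: scale.scale_left_diff_distrib)
  also have "\<dots> = (if i = j then euler_a n else 0) + ((-1) ^ j * signed_minor n i) *\<^sub>Q aU j"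
    using assms by (simp add: sum.distrib sum.delta euler_a_def)
  finally show ?thesis .
qed

lemma U_graded_differential:
  "graded_differential n (U_basis n) U_deg (U_diff_basis n :: _ \<Rightarrow> 'k::comm_ring_1 U_type)"
proof
  fix u i assume "u \<in> U_basis n" "U_deg u = Suc i"
  then show "(U_diff_basis n u :: 'k U_type) \<in> free_gr n (U_basis n) U_deg i"
    by (cases rule: U_basis_cases)
      (auto simp: U_diff_basis_b U_diff_basis_c euler_b_def intro!: free_gr_sum free_gr_diff)
next
  fix u assume "U_deg u = 0"
  then show "U_diff_basis n u = (0 :: 'k U_type)" by (cases u) auto
next
  fix u assume "u \<in> U_basis n"
  then show "lin_ext (U_diff_basis n) (U_diff_basis n u) = (0 :: 'k U_type)"
  proof (cases rule: U_basis_cases)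
    case (a i)
    then show ?thesis by (simp add: lin_ext_simps)
  next
    case (b j k)
    then show ?thesis by (simp add: U_diff_basis_b lin_ext_simps)
  next
    case (c j k)
    have "n \<ge> 1" using c(2) by simp
    then show ?thesis
      unfolding c(1) U_diff_basis_c lin_ext_diff diff_row_b[OF c(2,3)]
      by (simp add: diff_euler_b lin_ext_simps)
  qed
qed

text \<open>
  The formula for \<open>e\<^sub>i \<cdot> a\<^sub>i\<close> differs from the stated one: adding and subtracting \<open>x\<^sub>1\<^sub>i b\<^sub>1\<^sub>i\<close> completes
  both sums, and \<open>e\<^sub>i \<cdot> a\<^sub>j\<close> becomes one expression with a correction term on the diagonal. Likewise
  \<open>e\<^sub>i \<cdot> b\<^sub>j\<^sub>k\<close> absorbs its sign into the derivative of the signed minor. The lemmas \<open>e_a_same\<close> and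
  \<open>e_b_pdiff\<close> recover the stated formulas.
\<close>

fun U_action :: "nat \<Rightarrow> A_label \<Rightarrow> U_label \<Rightarrow> 'k::comm_ring_1 U_type" where
  "U_action n One_lab u = basis_elt u"
| "U_action n (E_lab i) (a_lab j) =
     (-1) ^ j *\<^sub>Q ((\<Sum>k = 1..n. xvar k j *\<^sub>Q bU k i) - (if i = j then euler_b n else 0))"
| "U_action n (E_lab i) (b_lab j k) = (\<Sum>l = 1..n. minor_deriv n i l k *\<^sub>Q cU l j)"
| "U_action n (E_lab i) (c_lab j k) = 0"
| "U_action n (T_lab i) (a_lab j) = (-1) ^ j *\<^sub>Q (\<Sum>k = 1..n. xvar k j *\<^sub>Q cU i k)"
| "U_action n (T_lab i) (b_lab j k) = 0"
| "U_action n (T_lab i) (c_lab j k) = 0"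

lemma U_action_One: "U_action n One_lab = basis_elt"
  by (intro ext) simp

lemma e_cU [simp]: "lin_ext (U_action n (E_lab i)) (cU j k) = 0"
  by (simp add: cU_def lin_ext_simps)

lemma T_cU [simp]: "lin_ext (U_action n (T_lab i)) (cU j k) = 0"
  by (simp add: cU_def lin_ext_simps)

text \<open>
  Together with \<open>c\<^sub>1\<^sub>1 = 0\<close> this yields \<open>e\<^sub>i \<cdot> euler_b = 0\<close>, so the correction term disappears from
  associativity and from the Leibniz rule for \<open>e\<^sub>i \<cdot> c\<^sub>j\<^sub>k\<close>.
\<close>

lemma e_row_b:
  assumes "m \<in> {1..n}" "i \<in> {1..n+1}"
  shows "lin_ext (U_action n (E_lab i)) (\<Sum>k = 1..n+1. xvar m k *\<^sub>Q bU j k) =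
    signed_minor n i *\<^sub>Q (cU m j :: 'k::comm_ring_1 U_type)"
proof -
  have "lin_ext (U_action n (E_lab i)) (\<Sum>k = 1..n+1. xvar m k *\<^sub>Q bU j k) =
      (\<Sum>l = 1..n. (\<Sum>k = 1..n+1. xvar m k * minor_deriv n i l k) *\<^sub>Q (cU l j :: 'k U_type))"
    unfolding lin_ext_simps lin_ext_basis_elt U_action.simps by (rule sum_scale_swap)
  also have "\<dots> = (\<Sum>l = 1..n. (if m = l then signed_minor n i else 0) *\<^sub>Q cU l j)"
    by (intro sum.cong refl) (simp only: sum_xvar_minor_deriv[OF assms(1) _ assms(2)])
  also have "\<dots> = signed_minor n i *\<^sub>Q cU m j"
    using assms(1) by (simp add: scale_if sum.delta')
  finally show ?thesis .
qed

lemma e_euler_b: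
  assumes "n \<ge> 1" "i \<in> {1..n+1}"
  shows "lin_ext (U_action n (E_lab i)) (euler_b n) = 0"
  unfolding euler_b_def using assms by (subst e_row_b) (auto simp: cU_def)

lemma T_row_b: "lin_ext (U_action n (T_lab i)) (\<Sum>k\<in>K. p k *\<^sub>Q bU (j k) (l k)) = 0"
  by (simp add: lin_ext_simps)

lemma T_euler_b: "lin_ext (U_action n (T_lab i)) (euler_b n) = 0"
  unfolding euler_b_def by (rule T_row_b)

lemma euler_b_degree: "n \<ge> 1 \<Longrightarrow> euler_b n \<in> free_gr n (U_basis n) U_deg 1"
  unfolding euler_b_def by (intro free_gr_sum free_gr_scale) auto

lemma U_action_degree:
  assumes "n \<ge> 1" "x \<in> A_basis n" "u \<in> U_basis n"
  shows "(U_action n x u :: 'k::comm_ring_1 U_type) \<in>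
    free_gr n (U_basis n) U_deg (A_deg x + U_deg u)"
  using assms(2,3)
  by (elim A_basis_cases U_basis_cases)
    (use euler_b_degree[OF assms(1)] in
      \<open>auto simp: numeral_2_eq_2[symmetric] intro!: free_gr_sum free_gr_diff free_gr_scale\<close>)

text \<open>
  Only the triple \<open>e\<^sub>i, e\<^sub>j, a\<^sub>k\<close> needs a computation: both sides are the same double sum over \<open>c\<^sub>m\<^sub>p\<close>,
  summed in different orders. Every other triple without the unit lands in degree at least 3.
\<close>

lemma U_action_assoc:
  assumes n: "n \<ge> 1" and x: "x \<in> A_basis n" and y: "y \<in> A_basis n" and u: "u \<in> U_basis n"
  shows "bilin_ext (U_action n) (A_mult_basis n x y) (basis_elt u) =
    lin_ext (U_action n x) (U_action n y u :: 'k::comm_ring_1 U_type)"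
proof -
  have e_e_a: "bilin_ext (U_action n) (A_mult_basis n (E_lab i) (E_lab j)) (aU k) =
      lin_ext (U_action n (E_lab i)) (U_action n (E_lab j) (a_lab k) :: 'k U_type)"
    if ij: "i \<in> {1..n+1}" "j \<in> {1..n+1}" for i j k
  proof -
    have "bilin_ext (U_action n) (A_mult_basis n (E_lab i) (E_lab j)) (aU k) =
        (\<Sum>m = 1..n. minor_deriv n i m j *\<^sub>Q (-1) ^ k *\<^sub>Q
          (\<Sum>p = 1..n. xvar p k *\<^sub>Q (cU m p :: 'k U_type)))"
      unfolding e_e_eq[OF ij] by (simp add: bilin_ext_def lin_ext_simps)
    also have "\<dots> =
        (\<Sum>m = 1..n. \<Sum>p = 1..n. (minor_deriv n i m j * (-1) ^ k * xvar p k) *\<^sub>Q cU m p)"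
      by (simp add: scale.scale_sum_right mult.assoc)
    also have "\<dots> =
        (\<Sum>p = 1..n. \<Sum>m = 1..n. (minor_deriv n i m j * (-1) ^ k * xvar p k) *\<^sub>Q cU m p)"
      by (rule sum.swap)
    also have "\<dots> = (-1) ^ k *\<^sub>Q
        (\<Sum>p = 1..n. xvar p k *\<^sub>Q (\<Sum>m = 1..n. minor_deriv n i m j *\<^sub>Q cU m p))"
      by (simp add: scale.scale_sum_right mult.assoc mult.commute mult.left_commute)
    also have "\<dots> = lin_ext (U_action n (E_lab i)) (U_action n (E_lab j) (a_lab k))"
      by (simp add: lin_ext_simps if_distrib[of "lin_ext _"] e_euler_b[OF n ij(1)] cong: if_cong)
    finally show ?thesis .
  qed
  show ?thesis
    using x y u
    by (elim A_basis_cases U_basis_cases)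
      \<comment> \<open>The one nontrivial triple is closed first, before simplification unfolds it.\<close>
      (simp_all only: e_e_a,
       simp_all add: U_action_One bilin_ext_def lin_ext_basis lin_ext_simps e_e_eq T_euler_b
         if_distrib[of "lin_ext _"] del: One_nat_def cong: if_cong)
qed

text \<open>
  The Leibniz rule for \<open>T\<^sub>i \<cdot> a\<^sub>j\<close>: apart from the correction term, both sides are the double sum of
  \<open>x\<^sub>i\<^sub>l x\<^sub>k\<^sub>j b\<^sub>k\<^sub>l\<close> over \<open>k\<close> and \<open>l\<close>.
\<close>

lemma sum_row_e_a:
  assumes "i \<in> {1..n}" "j \<in> {1..n+1}"
  shows "(\<Sum>l = 1..n+1. xvar i l *\<^sub>Q U_action n (E_lab l) (a_lab j)) =
    (-1) ^ j *\<^sub>Q (\<Sum>k = 1..n. xvar k j *\<^sub>Q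
      lin_ext (U_diff_basis n) (cU i k :: 'k::comm_ring_1 U_type))"
proof -
  have "(\<Sum>l = 1..n+1. xvar i l *\<^sub>Q U_action n (E_lab l) (a_lab j)) =
      (-1) ^ j *\<^sub>Q (\<Sum>l = 1..n+1. xvar i l *\<^sub>Q
        ((\<Sum>k = 1..n. xvar k j *\<^sub>Q bU k l) - (if l = j then euler_b n else (0 :: 'k U_type))))"
    unfolding U_action.simps scale.scale_sum_right scale.scale_left_commute[of "xvar i _"] ..
  also have "(\<Sum>l = 1..n+1. xvar i l *\<^sub>Q
        ((\<Sum>k = 1..n. xvar k j *\<^sub>Q bU k l) - (if l = j then euler_b n else 0))) =
      (\<Sum>l = 1..n+1. \<Sum>k = 1..n. (xvar i l * xvar k j) *\<^sub>Q bU k l) - xvar i j *\<^sub>Q (euler_b n :: 'k U_type)"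
    using assms(2)
    by (simp add: scale.scale_right_diff_distrib sum_subtractf scale.scale_sum_right scale_if_right sum.delta)
  also have "(\<Sum>l = 1..n+1. \<Sum>k = 1..n. (xvar i l * xvar k j) *\<^sub>Q bU k l) =
      (\<Sum>k = 1..n. \<Sum>l = 1..n+1. (xvar i l * xvar k j) *\<^sub>Q (bU k l :: 'k U_type))"
    by (rule sum.swap)
  also have "\<dots> - xvar i j *\<^sub>Q euler_b n =
      (\<Sum>k = 1..n. xvar k j *\<^sub>Q lin_ext (U_diff_basis n) (cU i k))"
    using assms(1)
    by (simp add: diff_cU scale.scale_right_diff_distrib sum_subtractf scale.scale_sum_right
        scale_if_right sum.delta' mult.commute)
  finally show ?thesis .
qed

text \<open>
  This lemma and the next are the two halves of the Leibniz rule for \<open>e\<^sub>i \<cdot> b\<^sub>j\<^sub>k\<close>: their right-hand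
  sides add up to \<open>f\<^sub>i b\<^sub>j\<^sub>k\<close>, the terms in \<open>b\<^sub>j\<^sub>i\<close> and \<open>euler_b\<close> cancelling.
\<close>

lemma diff_e_b:
  assumes "i \<in> {1..n+1}" "j \<in> {1..n}" "k \<in> {1..n+1}"
  shows "lin_ext (U_diff_basis n) (U_action n (E_lab i) (b_lab j k)) =
    signed_minor n i *\<^sub>Q bU j k - signed_minor n k *\<^sub>Q bU j i -
    minor_deriv n i j k *\<^sub>Q (euler_b n :: 'k::comm_ring_1 U_type)"
proof -
  have "lin_ext (U_diff_basis n) (U_action n (E_lab i) (b_lab j k)) =
      (\<Sum>m = 1..n. minor_deriv n i m k *\<^sub>Q (\<Sum>l = 1..n+1. xvar m l *\<^sub>Q bU j l)) -
      (\<Sum>m = 1..n. minor_deriv n i m k *\<^sub>Q (if m = j then euler_b n else (0 :: 'k U_type)))"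
    by (simp add: lin_ext_simps diff_cU scale.scale_right_diff_distrib sum_subtractf)
  also have "(\<Sum>m = 1..n. minor_deriv n i m k *\<^sub>Q (\<Sum>l = 1..n+1. xvar m l *\<^sub>Q bU j l)) =
      (\<Sum>l = 1..n+1. ((if k = l then signed_minor n i else 0) -
        (if i = l then signed_minor n k else 0)) *\<^sub>Q (bU j l :: 'k U_type))"
    unfolding sum_scale_swap
    by (intro sum.cong refl) (simp only: sum_minor_deriv_xvar_rows[OF assms(3) _ assms(1)])
  also have "\<dots> = signed_minor n i *\<^sub>Q bU j k - signed_minor n k *\<^sub>Q bU j i"
    using assms by (simp add: scale.scale_left_diff_distrib sum_subtractf scale_if sum.delta')
  also have "(\<Sum>m = 1..n. minor_deriv n i m k *\<^sub>Q (if m = j then euler_b n else (0 :: 'k U_type))) =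
      minor_deriv n i j k *\<^sub>Q euler_b n"
    using assms(2) by (simp add: scale_if_right sum.delta)
  finally show ?thesis .
qed

lemma e_diff_b:
  assumes "i \<in> {1..n+1}" "j \<in> {1..n}" "k \<in> {1..n+1}"
  shows "lin_ext (U_action n (E_lab i)) (U_diff_basis n (b_lab j k)) =
    signed_minor n k *\<^sub>Q bU j i + minor_deriv n i j k *\<^sub>Q (euler_b n :: 'k::comm_ring_1 U_type)"
proof -
  have "lin_ext (U_action n (E_lab i)) (U_diff_basis n (b_lab j k)) =
      (\<Sum>l = 1..n+1. (- minor_deriv n l j k) *\<^sub>Q
        ((\<Sum>m = 1..n. xvar m l *\<^sub>Q bU m i) - (if i = l then euler_b n else (0 :: 'k U_type))))"
    unfolding U_diff_basis_b[OF assms(2,3)] lin_ext_simps lin_ext_basis_elt U_action.simps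
      scale.scale_scale minus_1_power_Suc_mult ..
  also have "\<dots> = minor_deriv n i j k *\<^sub>Q euler_b n -
      (\<Sum>l = 1..n+1. minor_deriv n l j k *\<^sub>Q (\<Sum>m = 1..n. xvar m l *\<^sub>Q bU m i))"
    using assms(1)
    by (simp add: scale.scale_right_diff_distrib sum_subtractf sum_negf scale_if_right sum.delta')
  also have "(\<Sum>l = 1..n+1. minor_deriv n l j k *\<^sub>Q (\<Sum>m = 1..n. xvar m l *\<^sub>Q bU m i)) =
      (\<Sum>m = 1..n. (if m = j then - signed_minor n k else 0) *\<^sub>Q (bU m i :: 'k U_type))"
    unfolding sum_scale_swap
    by (intro sum.cong refl) (simp only: sum_minor_deriv_xvar_border[OF _ assms(2,3)])
  also have "\<dots> = - (signed_minor n k *\<^sub>Q bU j i)"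
    using assms(2) by (simp add: scale_if sum.delta)
  finally show ?thesis by simp
qed

text \<open>
  The terms \<open>\<partial>(T\<^sub>i) \<cdot> b\<^sub>j\<^sub>k\<close> and \<open>T\<^sub>i \<cdot> \<partial>(b\<^sub>j\<^sub>k)\<close> of the Leibniz rule for \<open>T\<^sub>i \<cdot> b\<^sub>j\<^sub>k = 0\<close> are opposite.
\<close>

lemma sum_row_e_b:
  assumes "i \<in> {1..n}" "j \<in> {1..n}" "k \<in> {1..n+1}"
  shows "(\<Sum>l = 1..n+1. xvar i l *\<^sub>Q U_action n (E_lab l) (b_lab j k)) =
    - (signed_minor n k *\<^sub>Q (cU i j :: 'k::comm_ring_1 U_type))"
proof -
  have "(\<Sum>l = 1..n+1. xvar i l *\<^sub>Q U_action n (E_lab l) (b_lab j k)) =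
      (\<Sum>m = 1..n. (\<Sum>l = 1..n+1. minor_deriv n l m k * xvar i l) *\<^sub>Q (cU m j :: 'k U_type))"
    unfolding U_action.simps sum_scale_swap by (simp only: mult.commute)
  also have "\<dots> = (\<Sum>m = 1..n. (if i = m then - signed_minor n k else 0) *\<^sub>Q cU m j)"
    by (intro sum.cong refl) (simp only: sum_minor_deriv_xvar_border[OF assms(1) _ assms(3)])
  also have "\<dots> = - (signed_minor n k *\<^sub>Q cU i j)"
    using assms(1) by (simp add: scale_if sum.delta')
  finally show ?thesis .
qed

lemma T_diff_b:
  assumes "i \<in> {1..n}" "j \<in> {1..n}" "k \<in> {1..n+1}"
  shows "lin_ext (U_action n (T_lab i)) (U_diff_basis n (b_lab j k)) =
    signed_minor n k *\<^sub>Q (cU i j :: 'k::comm_ring_1 U_type)"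
proof -
  have "lin_ext (U_action n (T_lab i)) (U_diff_basis n (b_lab j k)) =
      - (\<Sum>l = 1..n+1. minor_deriv n l j k *\<^sub>Q (\<Sum>m = 1..n. xvar m l *\<^sub>Q (cU i m :: 'k U_type)))"
    unfolding U_diff_basis_b[OF assms(2,3)] lin_ext_simps lin_ext_basis_elt U_action.simps
      scale.scale_scale minus_1_power_Suc_mult scale.scale_minus_left sum_negf ..
  also have "(\<Sum>l = 1..n+1. minor_deriv n l j k *\<^sub>Q (\<Sum>m = 1..n. xvar m l *\<^sub>Q (cU i m :: 'k U_type))) =
      (\<Sum>m = 1..n. (if m = j then - signed_minor n k else 0) *\<^sub>Q cU i m)"
    unfolding sum_scale_swap
    by (intro sum.cong refl) (simp only: sum_minor_deriv_xvar_border[OF _ assms(2,3)])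
  also have "\<dots> = - (signed_minor n k *\<^sub>Q cU i j)"
    using assms(2) by (simp add: scale_if sum.delta)
  finally show ?thesis by simp
qed

lemma diff_e_a:
  assumes "n \<ge> 1" "i \<in> {1..n+1}" "j \<in> {1..n+1}"
  shows "lin_ext (U_diff_basis n) (U_action n (E_lab i) (a_lab j)) =
    signed_minor n i *\<^sub>Q (aU j :: 'k::comm_ring_1 U_type)"
proof -
  have "lin_ext (U_diff_basis n) (if i = j then euler_b n else (0 :: 'k U_type)) =
      (if i = j then euler_a n else 0)"
    by (simp add: diff_euler_b[OF assms(1)] lin_ext_zero)
  then have "lin_ext (U_diff_basis n) (U_action n (E_lab i) (a_lab j)) =
      (-1) ^ j *\<^sub>Q ((-1) ^ j * signed_minor n i) *\<^sub>Q (aU j :: 'k U_type)"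
    unfolding U_action.simps lin_ext_scale lin_ext_diff diff_column_b[OF assms(2,3)] by simp
  also have "\<dots> = signed_minor n i *\<^sub>Q aU j"
    by (simp flip: mult.assoc power_add)
  finally show ?thesis .
qed

lemma e_diff_c:
  assumes "i \<in> {1..n+1}" "j \<in> {1..n}" "k \<in> {1..n}"
  shows "lin_ext (U_action n (E_lab i)) (U_diff_basis n (c_lab j k)) =
    signed_minor n i *\<^sub>Q (cU j k :: 'k::comm_ring_1 U_type)"
proof -
  have n: "n \<ge> 1" using assms by simp
  show ?thesis
    unfolding U_diff_basis_c lin_ext_diff e_row_b[OF assms(2,1)]
    by (simp add: e_euler_b[OF n assms(1)] lin_ext_zero)
qed

lemma T_diff_c: "lin_ext (U_action n (T_lab i)) (U_diff_basis n (c_lab j k)) = 0"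
  by (simp add: U_diff_basis_c lin_ext_diff T_row_b T_euler_b lin_ext_zero)

lemma U_action_leibniz:
  assumes n: "n \<ge> 1" and x: "x \<in> A_basis n" and u: "u \<in> U_basis n"
  shows "lin_ext (U_diff_basis n) (U_action n x u) =
    bilin_ext (U_action n) (A_diff_basis n x) (basis_elt u) +
    (-1) ^ A_deg x *\<^sub>Q lin_ext (U_action n x) (U_diff_basis n u :: 'k::comm_ring_1 U_type)"
  using x
proof (cases rule: A_basis_cases)
  case one
  then show ?thesis by (simp add: U_action_One lin_ext_basis bilin_ext_def lin_ext_simps)
next
  case x: (e i)
  have dx: "bilin_ext (U_action n) (A_diff_basis n x) (basis_elt u) =
      signed_minor n i *\<^sub>Q (basis_elt u :: 'k U_type)"
    by (simp add: x(1) A_diff_basis_e bilin_ext_def lin_ext_simps)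
  show ?thesis using u
  proof (cases rule: U_basis_cases)
    case u: (a j)
    show ?thesis
      unfolding dx unfolding x(1) u(1) diff_e_a[OF n x(2) u(2)] by (simp add: lin_ext_zero)
  next
    case u: (b j k)
    show ?thesis
      unfolding dx unfolding x(1) u(1) diff_e_b[OF x(2) u(2,3)] e_diff_b[OF x(2) u(2,3)] by simp
  next
    case u: (c j k)
    have "cU j k = (basis_elt (c_lab j k) :: 'k U_type)" using u(4) by (auto simp: cU_def)
    then show ?thesis
      unfolding dx unfolding x(1) u(1) e_diff_c[OF x(2) u(2,3)] by (simp add: lin_ext_zero)
  qed
next
  case x: (T i)
  have dx: "bilin_ext (U_action n) (A_diff_basis n x) (basis_elt u) =
      (\<Sum>l = 1..n+1. xvar i l *\<^sub>Q (U_action n (E_lab l) u :: 'k U_type))"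
    by (simp add: x(1) bilin_ext_def lin_ext_simps)
  show ?thesis using u
  proof (cases rule: U_basis_cases)
    case u: (a j)
    show ?thesis
      unfolding dx unfolding x(1) u(1) sum_row_e_a[OF x(2) u(2)] by (simp add: lin_ext_simps)
  next
    case u: (b j k)
    show ?thesis
      unfolding dx unfolding x(1) u(1) sum_row_e_b[OF x(2) u(2,3)] T_diff_b[OF x(2) u(2,3)]
      by (simp add: lin_ext_simps)
  next
    case u: (c j k)
    show ?thesis
      unfolding dx unfolding x(1) u(1) T_diff_c by (simp add: lin_ext_simps)
  qed
qed

lemma U_dg_action:
  assumes "n \<ge> 1"
  shows "dg_action n (A_basis n) A_deg (A_diff_basis n) (U_basis n) U_deg (U_diff_basis n)
    One_lab (A_mult_basis n) (U_action n :: _ \<Rightarrow> _ \<Rightarrow> 'k::comm_ring_1 U_type)"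
  by (intro dg_action.intro A_graded_differential U_graded_differential dg_action_axioms.intro
      U_action_degree[OF assms] U_action_assoc[OF assms] U_action_leibniz[OF assms])
    simp_all

lemma U_free_module_record:
  "free_module_record n (U_basis n) (U_mod n :: ('k::comm_ring_1 xpoly, 'k U_type) module)"
  by standard (simp_all add: U_mod_def)

lemma e_a_same:
  assumes "i \<in> {1..n+1}" "n \<ge> 1"
  shows "U_action n (E_lab i) (a_lab i) = (-1) ^ (i + 1) *\<^sub>Q
    ((\<Sum>k \<in> {1..n+1} - {i}. xvar 1 k *\<^sub>Q bU 1 k) -
     (\<Sum>l = 2..n. xvar l i *\<^sub>Q (bU l i :: 'k::comm_ring_1 U_type)))"
proof -
  have "euler_b n = xvar 1 i *\<^sub>Q bU 1 i + (\<Sum>k \<in> {1..n+1} - {i}. xvar 1 k *\<^sub>Q (bU 1 k :: 'k U_type))"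
    unfolding euler_b_def using assms(1) by (intro sum.remove) auto
  moreover have "(\<Sum>l = 1..n. xvar l i *\<^sub>Q bU l i) =
      xvar 1 i *\<^sub>Q bU 1 i + (\<Sum>l = 2..n. xvar l i *\<^sub>Q (bU l i :: 'k U_type))"
    using assms(2) by (simp add: sum.atLeast_Suc_atMost numeral_2_eq_2)
  ultimately show ?thesis
    by (simp add: scale.scale_right_diff_distrib power_add del: One_nat_def)
qed

lemma e_b_pdiff:
  assumes "i \<in> {1..n+1}" "k \<in> {1..n+1}"
  shows "U_action n (E_lab i) (b_lab j k) = (-1) ^ (i + 1) *\<^sub>Q
    (\<Sum>l = 1..n. pdiff (l, k) (F_minor n i) *\<^sub>Q (cU l j :: 'k::comm_ring_1 U_type))"
proof -
  have "minor_deriv n i l k = (-1) ^ (i + 1) * pdiff (l, k) (F_minor n i :: 'k xpoly)"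
    if "l \<in> {1..n}" for l
    unfolding pdiff_F_minor[OF assms(1) that assms(2)] by (simp flip: mult.assoc power_add)
  then have "U_action n (E_lab i) (b_lab j k) =
      (\<Sum>l = 1..n. ((-1) ^ (i + 1) * pdiff (l, k) (F_minor n i)) *\<^sub>Q (cU l j :: 'k U_type))"
    unfolding U_action.simps by (intro sum.cong refl) simp
  then show ?thesis
    by (simp only: scale.scale_sum_right scale.scale_scale)
qed

theorem lemma5p1:
  fixes n :: nat
  assumes "n \<ge> 2"
  shows "\<exists>act :: 'k::field A_type \<Rightarrow> 'k U_type \<Rightarrow> 'k U_type.
    dg_module (Q_ring n) (A_alg n) (A_gr n) (A_diff n) (U_mod n) (U_gr n) (U_diff n) act \<and>
    (\<forall>i \<in> {1..n+1}. \<forall>j \<in> {1..n+1}. act (eA i) (aU j) =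
      (if i \<noteq> j then (-1) ^ j *\<^sub>Q (\<Sum>k = 1..n. xvar k j *\<^sub>Q bU k i)
       else (-1) ^ (i + 1) *\<^sub>Q
         ((\<Sum>k \<in> {1..n+1} - {i}. xvar 1 k *\<^sub>Q bU 1 k) - (\<Sum>l = 2..n. xvar l i *\<^sub>Q bU l i)))) \<and>
    (\<forall>i \<in> {1..n+1}. \<forall>j \<in> {1..n}. \<forall>k \<in> {1..n+1}. act (eA i) (bU j k) =
      (-1) ^ (i + 1) *\<^sub>Q (\<Sum>l = 1..n. pdiff (l, k) (F_minor n i) *\<^sub>Q cU l j)) \<and>
    (\<forall>i \<in> {1..n+1}. \<forall>j \<in> {1..n}. \<forall>k \<in> {1..n}. act (eA i) (cU j k) = 0) \<and>
    (\<forall>i \<in> {1..n}. \<forall>j \<in> {1..n+1}. act (TA i) (aU j) =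
      (-1) ^ j *\<^sub>Q (\<Sum>k = 1..n. xvar k j *\<^sub>Q cU i k)) \<and>
    (\<forall>i \<in> {1..n}. \<forall>j \<in> {1..n}. \<forall>k \<in> {1..n+1}. act (TA i) (bU j k) = 0) \<and>
    (\<forall>i \<in> {1..n}. \<forall>j \<in> {1..n}. \<forall>k \<in> {1..n}. act (TA i) (cU j k) = 0)"
proof (intro exI[of _ "bilin_ext (U_action n)"] conjI ballI)
  have n: "n \<ge> 1" using assms by simp
  have gr: "A_gr n = free_gr n (A_basis n) A_deg" "U_gr n = free_gr n (U_basis n) U_deg"
    by (intro ext, simp add: A_gr_def U_gr_def)+
  show "dg_module (Q_ring n) (A_alg n) (A_gr n) (A_diff n) (U_mod n) (U_gr n) (U_diff n)
      (bilin_ext (U_action n) :: 'k A_type \<Rightarrow> 'k U_type \<Rightarrow> 'k U_type)"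
    unfolding gr A_diff_def U_diff_def
    by (rule free_dg_module[OF A_dg_algebra A_free_module_record _ _ U_dg_action[OF n]
          U_free_module_record])
      (simp_all add: A_alg_def A_mult_eq)
  show "bilin_ext (U_action n) (eA i) (aU j) =
      (if i \<noteq> j then (-1) ^ j *\<^sub>Q (\<Sum>k = 1..n. xvar k j *\<^sub>Q bU k i)
       else (-1) ^ (i + 1) *\<^sub>Q
         ((\<Sum>k \<in> {1..n+1} - {i}. xvar 1 k *\<^sub>Q bU 1 k) -
          (\<Sum>l = 2..n. xvar l i *\<^sub>Q (bU l i :: 'k U_type))))"
    if "i \<in> {1..n+1}" for i j
  proof (cases "i = j")
    case True
    show ?thesis
      unfolding bilin_ext_basis_elt lin_ext_basis_elt True[symmetric] e_a_same[OF that n] by simp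
  qed simp
  show "bilin_ext (U_action n) (eA i) (bU j k) =
      (-1) ^ (i + 1) *\<^sub>Q (\<Sum>l = 1..n. pdiff (l, k) (F_minor n i) *\<^sub>Q (cU l j :: 'k U_type))"
    if "i \<in> {1..n+1}" "k \<in> {1..n+1}" for i j k
    unfolding bilin_ext_basis_elt lin_ext_basis_elt e_b_pdiff[OF that] ..
qed simp_all

end
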